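(* Let $m_1,m_2$ be positive real numbers with $m_1\leq 1.8m_2$. Let $\beta=\max\{x\in[0.5,1) : \frac{2(1-x)(1+x)^2}{x(x+2)}\geq \frac{m_1}{m_2}\}$ and $r_0=\frac{2}{1-\beta}m_1$. Let $G\in\mathcal{G}_{m_1,m_2}$ and let $r$ be an integer with $r\geq r_0$. If $\Delta(G)\leq r$, then $G$ has an equitable $r$-coloring.
   Context: All graphs are finite and simple. For a graph $H$, $|H|$ denotes its number of vertices and $\lVert H\rVert$ its number of edges; $\Delta(G)$ is the maximum degree. For real numbers $m_1,m_2$, $\mathcal{G}_{m_1,m_2}$ is the class of graphs $G$ such that $\lVert H\rVert\leq m_1|H|$ for every subgraph $H$ of $G$, and $\lVert H\rVert\leq m_2|H|$ for every bipartite subgraph $H$ of $G$. An equitable $r$-coloring of a graph is a partition of its vertex set into $r$ independent sets $V_1,\dots,V_r$ (some possibly empty) with $\big||V_i|-|V_j|\big|\leq 1$ for all $i,j$. (Equivalently, $\beta$ is the unique root in $[0.5,1)$ of $2m_2(1-x)(1+x)^2-m_1x(2+x)$.) *)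

theory Defs
  imports Complex_Main
begin

definition graph :: "'a set \<Rightarrow> 'a set set \<Rightarrow> bool" where
  "graph V E \<longleftrightarrow> finite V \<and> (\<forall>e\<in>E. e \<subseteq> V \<and> card e = 2)"

definition subgraph :: "'a set \<Rightarrow> 'a set set \<Rightarrow> 'a set \<Rightarrow> 'a set set \<Rightarrow> bool" where
  "subgraph W F V E \<longleftrightarrow> W \<subseteq> V \<and> F \<subseteq> E \<and> (\<forall>e\<in>F. e \<subseteq> W)"

definition bipartite :: "'a set \<Rightarrow> 'a set set \<Rightarrow> bool" where
  "bipartite W F \<longleftrightarrow> (\<exists>A\<subseteq>W. \<forall>e\<in>F. card (e \<inter> A) = 1 \<and> card (e - A) = 1)"

definition in_class :: "real \<Rightarrow> real \<Rightarrow> 'a set \<Rightarrow> 'a set set \<Rightarrow> bool" where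
  "in_class m1 m2 V E \<longleftrightarrow>
     (\<forall>W F. subgraph W F V E \<longrightarrow> real (card F) \<le> m1 * real (card W)) \<and>
     (\<forall>W F. subgraph W F V E \<and> bipartite W F \<longrightarrow> real (card F) \<le> m2 * real (card W))"

definition degree :: "'a set set \<Rightarrow> 'a \<Rightarrow> nat" where
  "degree E v = card {e\<in>E. v \<in> e}"

definition max_degree :: "'a set \<Rightarrow> 'a set set \<Rightarrow> nat" where
  "max_degree V E = Max (insert 0 (degree E ` V))"

definition equitable_coloring :: "'a set \<Rightarrow> 'a set set \<Rightarrow> nat \<Rightarrow> ('a \<Rightarrow> nat) \<Rightarrow> bool" where
  "equitable_coloring V E r c \<longleftrightarrow>
     (\<forall>v\<in>V. c v < r) \<and>
     (\<forall>e\<in>E. \<forall>u\<in>e. \<forall>v\<in>e. u \<noteq> v \<longrightarrow> c u \<noteq> c v) \<and>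
     (\<forall>i<r. \<forall>j<r. card {v\<in>V. c v = i} \<le> card {v\<in>V. c v = j} + 1)"

definition beta :: "real \<Rightarrow> real \<Rightarrow> real" where
  "beta m1 m2 = (GREATEST x. x \<in> {1/2..<1} \<and>
      2 * (1 - x) * (1 + x)^2 / (x * (x + 2)) \<ge> m1 / m2)"

definition r0 :: "real \<Rightarrow> real \<Rightarrow> real" where
  "r0 m1 m2 = 2 / (1 - beta m1 m2) * m1"

end

theory Submission
  imports Defs
begin

text \<open>
  Color the graph vertex by vertex, always leaving a vertex \<open>x\<close> of degree at most \<open>2 m1\<close> for last.
  A class is accessible if a chain of moves of single vertices between classes leads from it to a class
  of fewer than \<open>s\<close> vertices, where \<open>s\<close> is the target size. If \<open>a\<close> of the
  \<open>r\<close> classes are accessible, then every vertex outside them has a neighbor in each of them, so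
  \<open>a * (r - a) < m2 * r\<close>. By the choice of \<open>\<beta>\<close> this means \<open>a < lo\<close> or \<open>a > hi\<close>, where
  \<open>lo = \<beta> r / (2 (1 + \<beta>))\<close> and \<open>hi = r - lo\<close>. If \<open>x\<close> cannot be placed, it has a neighbor
  in each accessible class, whence \<open>a \<le> 2 m1 < hi\<close> and so \<open>a < lo\<close>.

  Counting degrees against \<open>m1\<close> then gives a vertex \<open>w\<close> of a small class and two
  nonadjacent vertices \<open>y1\<close>, \<open>y2\<close> outside the accessible classes such that \<open>w\<close> is their only
  neighbor in the small class and their own classes have small degree sum. Replace \<open>w\<close> by
  \<open>y1\<close> and \<open>y2\<close>. Now a class of small degree sum has room; it cannot dominate many
  classes, so more than \<open>hi\<close> classes are accessible. First \<open>x\<close> is placed, because its degree is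
  small, and then \<open>w\<close>, whose degree may be as large as \<open>r\<close>, by exchanging it repeatedly
  with single neighbors in accessible classes.
\<close>


section \<open>Partial colorings and accessible classes\<close>

definition nb :: "('a \<Rightarrow> 'a \<Rightarrow> bool) \<Rightarrow> 'a \<Rightarrow> 'a set \<Rightarrow> nat" where
  "nb adj v S = card {u\<in>S. adj v u}"

definition cls :: "'a set \<Rightarrow> ('a \<Rightarrow> nat) \<Rightarrow> nat \<Rightarrow> 'a set" where
  "cls C f i = {v\<in>C. f v = i}"

locale symmetric_graph =
  fixes V :: "'a set" and adj :: "'a \<Rightarrow> 'a \<Rightarrow> bool" and r :: nat
  assumes finite_V: "finite V"
    and adj_sym: "adj u v \<Longrightarrow> adj v u"
    and adj_irrefl: "\<not> adj v v"
begin

definition proper :: "'a set \<Rightarrow> ('a \<Rightarrow> nat) \<Rightarrow> bool" where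
  "proper C f \<longleftrightarrow> (\<forall>v\<in>C. f v < r) \<and> (\<forall>u\<in>C. \<forall>v\<in>C. adj u v \<longrightarrow> f u \<noteq> f v)"

definition free :: "'a set \<Rightarrow> ('a \<Rightarrow> nat) \<Rightarrow> 'a \<Rightarrow> nat \<Rightarrow> bool" where
  "free C f v k \<longleftrightarrow> (\<forall>u\<in>cls C f k. \<not> adj v u)"

text \<open>Only the last class of the list lies in \<open>M\<close>, so a shift along the list
  leaves all other classes of \<open>M\<close> unchanged.\<close>

fun shift_path :: "'a set \<Rightarrow> ('a \<Rightarrow> nat) \<Rightarrow> nat set \<Rightarrow> nat list \<Rightarrow> bool" where
  "shift_path C f M [] = False"
| "shift_path C f M [i] = (i \<in> M)"
| "shift_path C f M (i # k # p) =
     (i \<notin> M \<and> (\<exists>z\<in>cls C f i. free C f z k) \<and> shift_path C f M (k # p))"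

text \<open>Without repetitions in the list, altering its first class cannot spoil the moves still
  to come.\<close>

definition acc :: "'a set \<Rightarrow> ('a \<Rightarrow> nat) \<Rightarrow> nat set \<Rightarrow> nat set" where
  "acc C f M = {i. i < r \<and> (\<exists>p. distinct (i # p) \<and> shift_path C f M (i # p))}"

lemma nb_mono: "S \<subseteq> T \<Longrightarrow> finite T \<Longrightarrow> nb adj v S \<le> nb adj v T"
  unfolding nb_def by (rule card_mono) auto

lemma shift_path_cong:
  "\<forall>k\<in>set p. cls C f k = cls C' f' k \<Longrightarrow> shift_path C f M p = shift_path C' f' M p"
  by (induction C f M p rule: shift_path.induct) (auto simp: free_def)

lemma shift_path_suffix: "shift_path C f M (p @ i # q) \<Longrightarrow> shift_path C f M (i # q)"
proof (induction p)
  case (Cons a p)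
  then show ?case by (cases p) auto
qed simp

lemma acc_target: "i \<in> M \<Longrightarrow> i < r \<Longrightarrow> i \<in> acc C f M"
  unfolding acc_def by (auto intro!: exI[of _ "[]"])

lemma acc_less: "i \<in> acc C f M \<Longrightarrow> i < r"
  unfolding acc_def by auto

lemma finite_acc: "finite (acc C f M)"
  by (rule finite_subset[of _ "{..<r}"]) (auto simp: acc_less)

text \<open>Prepend \<open>i\<close> to the path from \<open>k\<close>. If \<open>i\<close> already
  occurs there, the tail starting at \<open>i\<close> serves instead; if \<open>i\<close> lies in
  \<open>M\<close>, it is a path by itself.\<close>

lemma acc_step:
  assumes "k \<in> acc C f M" "i < r" "z \<in> cls C f i" "free C f z k"
  shows "i \<in> acc C f M"
proof -
  obtain p where p: "distinct (k # p)" "shift_path C f M (k # p)"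
    using assms(1) unfolding acc_def by blast
  show ?thesis
  proof (cases "i \<in> set (k # p) \<or> i \<in> M")
    case True
    then show ?thesis
    proof
      assume "i \<in> set (k # p)"
      then obtain p1 p2 where s: "k # p = p1 @ i # p2" by (meson split_list)
      then have "distinct (i # p2)" using p(1) by (metis distinct_append)
      moreover have "shift_path C f M (i # p2)" using p(2) s by (metis shift_path_suffix)
      ultimately show ?thesis using assms(2) unfolding acc_def by blast
    qed (use assms(2) acc_target in blast)
  next
    case False
    then have "distinct (i # k # p)" "shift_path C f M (i # k # p)"
      using p assms(3,4) by auto
    then show ?thesis using assms(2) unfolding acc_def by blast
  qed
qed

lemma acc_dominates:
  assumes "k \<in> acc C f M" "z \<in> C" "f z < r" "f z \<notin> acc C f M"
  shows "\<exists>u\<in>cls C f k. adj z u"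
  using acc_step[OF assms(1,3), of z] assms(2,4) by (auto simp: cls_def free_def)

text \<open>Put \<open>v\<close> into the first class, uncolor there a vertex that fits into the
  next class, and go on with that vertex. The clauses on the classes of \<open>M\<close> are for
  later use: a class of small degree sum has to survive the shift, or to gain only the single vertex
  \<open>z\<close>.\<close>

lemma place_along_path:
  assumes "shift_path C f M (i # p)" "distinct (i # p)" "proper C f" "v \<notin> C"
    "free C f v i" "finite C" "M \<subseteq> {..<r}"
  shows "\<exists>f' j z. j \<in> M \<and> proper (insert v C) f' \<and> z \<in> insert v C
     \<and> (\<forall>k. card (cls (insert v C) f' k) = card (cls C f k) + (if k = j then 1 else 0))
     \<and> (\<forall>k\<in>M. k \<noteq> j \<longrightarrow> cls (insert v C) f' k = cls C f k)
     \<and> cls (insert v C) f' j = insert z (cls C f j)"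
  using assms
proof (induction p arbitrary: i C f v)
  case Nil
  define g where "g = f(v := i)"
  have i: "i \<in> M" using Nil by simp
  have c: "cls (insert v C) g k = (if k = i then insert v (cls C f k) else cls C f k)" for k
    using Nil(4) by (auto simp: cls_def g_def)
  have "proper (insert v C) g"
    using Nil i unfolding proper_def free_def cls_def g_def
    by (auto dest: adj_sym simp: adj_irrefl)
  moreover have "v \<notin> cls C f i" using Nil(4) by (simp add: cls_def)
  moreover have "finite (cls C f i)" using Nil(6) by (simp add: cls_def)
  ultimately show ?case using i c by (intro exI[of _ g] exI[of _ i] exI[of _ v]) auto
next
  case (Cons k q)
  obtain z where z: "z \<in> cls C f i" "free C f z k" and iM: "i \<notin> M"
    and path: "shift_path C f M (k # q)" using Cons.prems(1) by auto
  define g where "g = f(v := i)"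
  let ?C = "insert v (C - {z})" 
  have zC: "z \<in> C" "f z = i" using z by (auto simp: cls_def)
  have vz: "v \<noteq> z" using zC Cons.prems(4) by auto
  have ci: "cls ?C g i = insert v (cls C f i - {z})"
    using Cons.prems(4) by (auto simp: cls_def g_def)
  have cj: "cls ?C g j = cls C f j" if "j \<noteq> i" for j
    using Cons.prems(4) zC that by (auto simp: cls_def g_def)
  have fin: "finite (cls C f i)" using Cons.prems by (simp add: cls_def)
  have card_i: "card (cls ?C g i) = card (cls C f i)"
  proof -
    have "v \<notin> cls C f i - {z}" using Cons.prems(4) by (simp add: cls_def)
    then show ?thesis unfolding ci using fin card.remove[OF fin z(1)] by simp
  qed
  have card_eq: "card (cls ?C g j) = card (cls C f j)" for j
    using card_i cj by (cases "j = i") auto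
  have "shift_path ?C g M (k # q)"
  proof -
    have "\<forall>j\<in>set (k # q). cls ?C g j = cls C f j" using Cons.prems(2) by (intro ballI cj) auto
    then show ?thesis using path shift_path_cong by blast
  qed
  moreover have "proper ?C g"
    using Cons.prems(3,5) zC unfolding proper_def free_def cls_def g_def
    by (auto dest: adj_sym simp: adj_irrefl)
  moreover have "free ?C g z k" using z(2) cj[of k] Cons.prems(2) unfolding free_def by auto
  moreover have "z \<notin> ?C" "finite ?C" using vz Cons.prems by auto
  moreover have "distinct (k # q)" using Cons.prems by simp
  ultimately obtain f' j y where f': "j \<in> M" "proper (insert z ?C) f'" "y \<in> insert z ?C"
      "\<forall>k. card (cls (insert z ?C) f' k) = card (cls ?C g k) + (if k = j then 1 else 0)"
      "\<forall>k\<in>M. k \<noteq> j \<longrightarrow> cls (insert z ?C) f' k = cls ?C g k"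
      "cls (insert z ?C) f' j = insert y (cls ?C g j)"
    using Cons.IH[of ?C g k z] Cons.prems(7) by blast
  have ins: "insert z ?C = insert v C" using zC by auto
  have "j \<noteq> i" using f'(1) iM by auto
  have "\<forall>k\<in>M. k \<noteq> j \<longrightarrow> cls (insert v C) f' k = cls C f k"
    using f'(5) cj iM unfolding ins by metis
  moreover have "cls (insert v C) f' j = insert y (cls C f j)"
    using f'(6) cj[OF \<open>j \<noteq> i\<close>] unfolding ins by simp
  ultimately show ?case using f'(1-4) card_eq unfolding ins by metis
qed

lemma place:
  assumes "proper C f" "v \<notin> C" "i \<in> acc C f M" "free C f v i" "finite C" "M \<subseteq> {..<r}"
  obtains f' j z where "j \<in> M" "proper (insert v C) f'" "z \<in> insert v C"
     "\<And>k. card (cls (insert v C) f' k) = card (cls C f k) + (if k = j then 1 else 0)"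
     "\<And>k. k \<in> M \<Longrightarrow> k \<noteq> j \<Longrightarrow> cls (insert v C) f' k = cls C f k"
     "cls (insert v C) f' j = insert z (cls C f j)"
proof -
  obtain p where "distinct (i # p)" "shift_path C f M (i # p)"
    using assms(3) unfolding acc_def by blast
  from place_along_path[OF this(2,1) assms(1,2,4-6)] that show ?thesis by blast
qed

section \<open>Counting neighbors and degrees of classes\<close>

lemma card_le_nb:
  assumes "finite S" "\<And>k. k \<in> A \<Longrightarrow> \<exists>u\<in>cls S f k. adj z u"
  shows "card A \<le> nb adj z S"
proof -
  have "A \<subseteq> f ` {u\<in>S. adj z u}" using assms(2) by (fastforce simp: cls_def)
  then have "card A \<le> card (f ` {u\<in>S. adj z u})" using assms(1) by (intro card_mono) auto
  also have "\<dots> \<le> card {u\<in>S. adj z u}" using assms(1) by (intro card_image_le) auto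
  finally show ?thesis unfolding nb_def .
qed

lemma free_acc_class:
  assumes "finite C" "nb adj x C < card (acc C f M)"
  obtains i where "i \<in> acc C f M" "free C f x i"
  using card_le_nb[of C "acc C f M" f x] assms unfolding free_def by (meson not_le)

definition outside :: "'a set \<Rightarrow> ('a \<Rightarrow> nat) \<Rightarrow> nat set \<Rightarrow> 'a set" where
  "outside C f M = {v\<in>C. f v \<notin> acc C f M}"

text \<open>Degrees are taken in all of \<open>V\<close>, not only among the colored vertices, so
  the value depends on the class alone.\<close>

definition degsum :: "'a set \<Rightarrow> nat" where
  "degsum S = (\<Sum>y\<in>S. nb adj y V)"

lemma card_le_sum_nb:
  assumes "finite S" "finite T" "\<And>z. z \<in> T \<Longrightarrow> \<exists>u\<in>S. adj z u"
  shows "card T \<le> (\<Sum>u\<in>S. nb adj u T)"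
proof -
  have "T \<subseteq> (\<Union>u\<in>S. {z\<in>T. adj u z})" using assms(3) adj_sym by fastforce
  then have "card T \<le> card (\<Union>u\<in>S. {z\<in>T. adj u z})" using assms by (intro card_mono) auto
  also have "\<dots> \<le> (\<Sum>u\<in>S. card {z\<in>T. adj u z})" using assms(1) by (rule card_UN_le)
  finally show ?thesis unfolding nb_def .
qed

text \<open>An accessible class dominates all vertices outside the accessible classes, hence sends
  at least one edge to each.\<close>

lemma outside_le_degsum:
  assumes "proper C f" "C \<subseteq> V" "k \<in> acc C f M"
  shows "card (outside C f M) \<le> degsum (cls C f k)"
proof -
  have fin: "finite C" using assms(2) finite_V by (rule finite_subset)
  have "card (outside C f M) \<le> (\<Sum>u\<in>cls C f k. nb adj u (outside C f M))"
    using fin assms(1,3) acc_dominates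
    by (intro card_le_sum_nb) (auto simp: outside_def proper_def cls_def)
  also have "\<dots> \<le> degsum (cls C f k)" unfolding degsum_def
    using assms(2) finite_V by (intro sum_mono nb_mono) (auto simp: outside_def)
  finally show ?thesis .
qed

lemma card_eq_sum_cls:
  assumes "finite C" "finite K"
  shows "card {v\<in>C. f v \<in> K} = (\<Sum>i\<in>K. card (cls C f i))"
proof -
  have "{v\<in>C. f v \<in> K} = (\<Union>i\<in>K. cls C f i)" by (auto simp: cls_def)
  also have "card \<dots> = (\<Sum>i\<in>K. card (cls C f i))"
    using assms by (intro card_UN_disjoint) (auto simp: cls_def)
  finally show ?thesis .
qed

lemma card_outside:
  assumes "proper C f" "finite C"
  shows "card (outside C f M) = (\<Sum>i\<in>{..<r} - acc C f M. card (cls C f i))"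
proof -
  have "outside C f M = {v\<in>C. f v \<in> {..<r} - acc C f M}"
    using assms(1) unfolding outside_def proper_def by auto
  then show ?thesis using card_eq_sum_cls[OF assms(2), of "{..<r} - acc C f M" f] by simp
qed

lemma card_compl_acc: "card ({..<r} - acc C f M) = r - card (acc C f M)" "card (acc C f M) \<le> r"
proof -
  have "acc C f M \<subseteq> {..<r}" by (auto simp: acc_less)
  then show "card ({..<r} - acc C f M) = r - card (acc C f M)" "card (acc C f M) \<le> r"
    using finite_acc card_mono[of "{..<r}"] by (auto simp: card_Diff_subset)
qed

lemma degsum_mono: "S \<subseteq> T \<Longrightarrow> finite T \<Longrightarrow> degsum S \<le> degsum T"
  unfolding degsum_def by (intro sum_mono2) auto

lemma sum_nb_swap:
  assumes "finite P" "finite Q"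
  shows "(\<Sum>u\<in>P. nb adj u Q) = (\<Sum>v\<in>Q. nb adj v P)"
proof -
  have nb: "nb adj u S = (\<Sum>v\<in>S. if adj u v then 1 else 0)" if "finite S" for u S
    unfolding nb_def using that by (simp flip: sum.inter_filter)
  have "(\<Sum>u\<in>P. nb adj u Q) = (\<Sum>v\<in>Q. \<Sum>u\<in>P. if adj u v then 1 else 0)"
    using assms by (simp add: nb sum.swap[of _ P])
  also have "\<dots> = (\<Sum>v\<in>Q. nb adj v P)"
    using assms adj_sym by (intro sum.cong refl) (simp add: nb, metis)
  finally show ?thesis .
qed

lemma sum_degsum:
  assumes "finite C" "finite K"
  shows "(\<Sum>i\<in>K. degsum (cls C f i)) = (\<Sum>v\<in>{v\<in>C. f v \<in> K}. nb adj v V)"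
proof -
  have "{v\<in>C. f v \<in> K} = (\<Union>i\<in>K. cls C f i)" by (auto simp: cls_def)
  then show ?thesis unfolding degsum_def
    using assms by (auto simp: cls_def intro!: sum.UNION_disjoint[symmetric])
qed

end

section \<open>Graphs in the sparse class\<close>

text \<open>The edge bounds of the class are stated through neighbor counts and pass to subsets of
  \<open>V\<close>. For the intended \<beta>, \<open>m1_le\<close> says that \<open>r\<close> is at
  least \<open>r0\<close>, and \<open>m2_le\<close> follows from it by the equation that defines
  \<beta>.\<close>

locale sparse_graph = symmetric_graph V adj r for V :: "'a set" and adj r +
  fixes m1 m2 \<beta> :: real
  assumes density: "R \<subseteq> V \<Longrightarrow> real (\<Sum>u\<in>R. nb adj u R) \<le> 2 * m1 * real (card R)"
    and bip_density: "P \<subseteq> V \<Longrightarrow> Q \<subseteq> V \<Longrightarrow> P \<inter> Q = {} \<Longrightarrow>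
      real (\<Sum>u\<in>P. nb adj u Q) \<le> m2 * (real (card P) + real (card Q))"
    and nb_le: "v \<in> V \<Longrightarrow> nb adj v V \<le> r"
    and r_pos: "r > 0" and m1_pos: "m1 > 0" and m2_pos: "m2 > 0"
    and beta_ge: "1/2 \<le> \<beta>" and beta_less: "\<beta> < 1"
    and m1_le: "2 * m1 \<le> (1 - \<beta>) * r"
    and m2_le: "4 * (1 + \<beta>)^2 * m2 \<le> \<beta> * (2 + \<beta>) * r"
begin

section \<open>Numerical bounds\<close>

definition lo :: real where "lo = \<beta> * r / (2 * (1 + \<beta>))"
text \<open>\<open>lo\<close> and \<open>hi\<close> are the two solutions \<open>a\<close> of
  \<open>a * (r - a) = \<beta> * (2 + \<beta>) * r^2 / (4 * (1 + \<beta>)^2)\<close>, and the right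
  side is the bound on \<open>m2 * r\<close> given by \<open>m2_le\<close>.\<close>

definition hi :: real where "hi = (2 + \<beta>) * r / (2 * (1 + \<beta>))"

text \<open>In units of \<open>q\<close> the later inequalities become polynomial in
  \<beta>.\<close>

lemma lo_hi_scale:
  obtains q where "0 < q" "real r = 2 * (1 + \<beta>) * q" "lo = \<beta> * q" "hi = (2 + \<beta>) * q"
proof
  show "0 < real r / (2 * (1 + \<beta>))" using beta_ge r_pos by simp
qed (use beta_ge in \<open>auto simp: lo_def hi_def\<close>)

lemma lo_plus_hi: "lo + hi = r"
  by (rule lo_hi_scale) (simp add: algebra_simps)

lemma lo_le: "lo \<le> r / 4"
proof (rule lo_hi_scale)
  fix q assume q: "0 < q" "real r = 2 * (1 + \<beta>) * q" "lo = \<beta> * q"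
  have "\<beta> * q \<le> 1 * q" using q(1) beta_less by (intro mult_right_mono) auto
  then show ?thesis unfolding q by (simp add: algebra_simps)
qed

lemma hi_ge: "hi \<ge> 3 * r / 4"
  using lo_le lo_plus_hi by linarith

lemma m1_le_half: "2 * m1 \<le> r / 2"
proof -
  have "(1 - \<beta>) * r \<le> (1/2) * r" using beta_ge by (intro mult_right_mono) auto
  then show ?thesis using m1_le by linarith
qed

lemma m2_r_le: "m2 * r \<le> lo * hi"
proof (rule lo_hi_scale)
  fix q assume q: "0 < q" "real r = 2 * (1 + \<beta>) * q" "lo = \<beta> * q" "hi = (2 + \<beta>) * q"
  have "(2 * (1 + \<beta>)) * (2 * (1 + \<beta>) * m2) \<le> (2 * (1 + \<beta>)) * (\<beta> * (2 + \<beta>) * q)"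
    using m2_le unfolding q(2) by (simp add: power2_eq_square algebra_simps)
  then have "2 * (1 + \<beta>) * m2 \<le> \<beta> * (2 + \<beta>) * q"
    using beta_ge by (subst (asm) mult_le_cancel_left_pos) auto
  then have "2 * (1 + \<beta>) * m2 * q \<le> \<beta> * (2 + \<beta>) * q * q" using q(1) by (intro mult_right_mono) auto
  then show ?thesis unfolding q by (simp add: algebra_simps)
qed

text \<open>For \<open>place_any\<close>, where a vertex that cannot be placed has more than
  \<open>2 * hi - r - 1\<close> neighbors to exchange with. The slack between
  \<open>2 * hi - r\<close> and \<open>(1 - \<beta>) * r\<close> is \<open>2 * \<beta> * lo\<close>,
  which is at least 1.\<close>

lemma swap_degree_bound:
  assumes "1 \<le> lo"
  shows "2 * m1 \<le> 2 * hi - r - 1"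
proof (rule lo_hi_scale)
  fix q assume q: "0 < q" "real r = 2 * (1 + \<beta>) * q" "lo = \<beta> * q" "hi = (2 + \<beta>) * q"
  have "1 * 1 \<le> (2 * \<beta>) * lo" using assms beta_ge by (intro mult_mono) auto
  also have "(2 * \<beta>) * lo = 2 * hi - r - (1 - \<beta>) * r" unfolding q by (simp add: algebra_simps)
  finally show ?thesis using m1_le by linarith
qed

text \<open>The numerical contradiction behind \<open>solo_pair\<close>. As \<open>a\<close> is at
  least 1, \<open>hi - 2 * a + 1\<close> may be replaced by \<open>hi - a\<close>, which turns the
  right side into \<open>F a\<close>; then \<open>F a\<close> is compared with
  \<open>F lo\<close>.\<close>

lemma counting_bound:
  fixes a :: real
  assumes "1 \<le> a" "a < lo"
  shows "2 * m1 * r < (r - 2 * a) * hi + 2 * a^2 - ((hi - 2 * a + 1) / 2)^2"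
proof -
  have r: "real r > 0" using r_pos by simp
  define F where "F t = r * hi - 2 * t * hi + 2 * t^2 - (hi - t)^2 / 4" for t :: real
  \<comment> \<open>The product is the difference of the two sides of \<open>poly\<close>; its sign
    rests on \<beta> being at least 1/2.\<close>
  have "0 \<le> (2 * \<beta> - 1) * (2 * \<beta>^2 + 4 * \<beta> + 1)" using beta_ge by (intro mult_nonneg_nonneg) auto
  then have poly: "4 * (1 - \<beta>) * (1 + \<beta>)^2 \<le> 3 + 2 * \<beta> + 2 * \<beta>^2"
    by (simp add: power2_eq_square algebra_simps)
  have "(1 - \<beta>) * (real r)^2 \<le> F lo"
  proof (rule lo_hi_scale)
    fix q assume q: "0 < q" "real r = 2 * (1 + \<beta>) * q" "lo = \<beta> * q" "hi = (2 + \<beta>) * q"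
    have "F lo = (3 + 2 * \<beta> + 2 * \<beta>^2) * q^2"
      unfolding F_def q by (simp add: power2_eq_square algebra_simps)
    moreover have "(1 - \<beta>) * (real r)^2 = 4 * (1 - \<beta>) * (1 + \<beta>)^2 * q^2"
      unfolding q by (simp add: power2_eq_square algebra_simps)
    ultimately show ?thesis using poly by (simp add: mult_right_mono)
  qed
  moreover have "F a - F lo = (lo - a) * (3/2 * hi - 7/4 * (a + lo))"
    unfolding F_def by (simp add: power2_eq_square field_simps)
  \<comment> \<open>The second factor exceeds \<open>9/8 * r - 7/8 * r\<close>.\<close>
  moreover have "(lo - a) * (3/2 * hi - 7/4 * (a + lo)) > 0"
    using assms lo_le hi_ge r by (intro mult_pos_pos) auto
  ultimately have "(1 - \<beta>) * (real r)^2 < F a" by linarith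
  moreover have "(hi - 2 * a + 1)^2 \<le> (hi - a)^2"
    using assms lo_le hi_ge r by (intro power_mono) auto
  moreover have "2 * m1 * r \<le> (1 - \<beta>) * (real r)^2"
    using mult_right_mono[OF m1_le, of r] by (simp add: power2_eq_square)
  ultimately show ?thesis unfolding F_def by (simp add: power_divide algebra_simps)
qed

section \<open>Sparsity and accessible classes\<close>

lemma exists_low_degree:
  assumes "V \<noteq> {}"
  obtains x where "x \<in> V" "real (nb adj x V) \<le> 2 * m1"
proof (rule ccontr)
  assume "\<not> thesis"
  then have "\<forall>x\<in>V. 2 * m1 < real (nb adj x V)" using that by fastforce
  then have "(\<Sum>x\<in>V. 2 * m1) < (\<Sum>x\<in>V. real (nb adj x V))"
    using assms finite_V by (intro sum_strict_mono) auto
  then show False using density[of V] by (simp add: mult.commute)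
qed

text \<open>Every outside vertex has a neighbor in each accessible class, and these edges form a
  bipartite graph on \<open>C\<close>.\<close>

lemma acc_edge_count:
  assumes "proper C f" "C \<subseteq> V"
  shows "real (card (acc C f M)) * real (card (outside C f M)) \<le> m2 * real (card C)"
proof -
  let ?A = "acc C f M" and ?Q = "outside C f M"
  define P where "P = C - ?Q"
  have fin: "finite C" using assms(2) finite_V by (rule finite_subset)
  have "card ?A \<le> nb adj z P" if "z \<in> ?Q" for z
  proof (rule card_le_nb)
    fix k assume k: "k \<in> ?A"
    have "\<exists>u\<in>cls C f k. adj z u"
      using acc_dominates[OF k, of z] that assms(1) unfolding outside_def proper_def by auto
    moreover have "cls C f k \<subseteq> cls P f k" using k by (auto simp: P_def outside_def cls_def)
    ultimately show "\<exists>u\<in>cls P f k. adj z u" by blast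
  qed (use fin P_def in auto)
  then have "real (\<Sum>z\<in>?Q. card ?A) \<le> real (\<Sum>z\<in>?Q. nb adj z P)"
    by (intro of_nat_mono sum_mono)
  also have "\<dots> \<le> m2 * (real (card ?Q) + real (card P))"
    using assms(2) by (intro bip_density) (auto simp: P_def outside_def)
  also have "real (card ?Q) + real (card P) = real (card C)"
  proof -
    have "?Q \<subseteq> C" by (auto simp: outside_def)
    then show ?thesis using fin unfolding P_def
      by (simp add: card_Diff_subset finite_subset card_mono of_nat_diff)
  qed
  finally show ?thesis by (simp add: mult.commute)
qed

definition nonfull :: "'a set \<Rightarrow> ('a \<Rightarrow> nat) \<Rightarrow> nat \<Rightarrow> nat set" where
  "nonfull C f s = {i. i < r \<and> card (cls C f i) < s}"

definition fits :: "'a set \<Rightarrow> ('a \<Rightarrow> nat) \<Rightarrow> nat \<Rightarrow> bool" where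
  "fits C f s \<longleftrightarrow> C \<subseteq> V \<and> proper C f \<and> (\<forall>i<r. card (cls C f i) \<le> s)"

lemma card_proper:
  assumes "proper C f" "finite C"
  shows "card C = (\<Sum>i<r. card (cls C f i))"
proof -
  have "C = {v\<in>C. f v \<in> {..<r}}" using assms(1) by (auto simp: proper_def)
  then show ?thesis using card_eq_sum_cls[OF assms(2), of "{..<r}" f] by simp
qed

text \<open>Since \<open>lo + hi = r\<close>, the product \<open>a * (r - a)\<close> is at least
  \<open>lo * hi\<close> between \<open>lo\<close> and \<open>hi\<close>.\<close>

lemma product_dichotomy:
  fixes a :: real
  assumes "a * (r - a) < lo * hi"
  shows "a < lo \<or> hi < a"
proof (rule ccontr)
  assume "\<not> ?thesis"
  then have "0 \<le> (a - lo) * (hi - a)" by (intro mult_nonneg_nonneg) auto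
  moreover have "(a - lo) * (hi - a) = a * (lo + hi - a) - lo * hi" by (simp add: algebra_simps)
  ultimately show False using assms lo_plus_hi by simp
qed

text \<open>Nonfull classes are themselves accessible, so each inaccessible class has exactly
  \<open>s\<close> vertices.\<close>

lemma card_outside_nonfull:
  assumes "fits C f s"
  shows "card (outside C f (nonfull C f s)) = (r - card (acc C f (nonfull C f s))) * s"
proof -
  let ?M = "nonfull C f s"
  have fin: "finite C" using assms finite_subset[OF _ finite_V] unfolding fits_def by blast
  have "card (outside C f ?M) = (\<Sum>i\<in>{..<r} - acc C f ?M. card (cls C f i))"
    using card_outside assms fin unfolding fits_def by blast
  also have "\<dots> = (\<Sum>i\<in>{..<r} - acc C f ?M. s)"
  proof (rule sum.cong[OF refl])
    fix i assume i: "i \<in> {..<r} - acc C f ?M"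
    then have "i \<notin> ?M" using acc_target by blast
    then show "card (cls C f i) = s" using i assms unfolding nonfull_def fits_def by fastforce
  qed
  finally show ?thesis by (simp add: card_compl_acc)
qed

lemma card_less_if_nonfull:
  assumes "fits C f s" "j \<in> nonfull C f s"
  shows "card C < r * s"
proof -
  have fin: "finite C" and pr: "proper C f"
    using assms(1) finite_subset[OF _ finite_V] unfolding fits_def by auto
  have "card C < (\<Sum>i<r. s)" unfolding card_proper[OF pr fin]
    using assms by (intro sum_strict_mono_ex1) (auto simp: fits_def nonfull_def)
  then show ?thesis by simp
qed

text \<open>Needed when \<open>y1\<close> and \<open>y2\<close> come from the same class \<open>Y\<close>, which then has \<open>s - 2\<close> vertices and must
  itself be refilled. Inaccessible classes may have \<open>s - 1\<close> vertices here, so the dichotomy for \<open>a\<close>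
  holds only up to an error term.\<close>

lemma acc_dichotomy:
  assumes "fits C f s" "j \<in> nonfull C f s"
  shows "card (acc C f (nonfull C f s)) < lo \<or> hi < card (acc C f (nonfull C f s))"
proof (rule product_dichotomy)
  let ?a = "card (acc C f (nonfull C f s))"
  have pr: "proper C f" and CV: "C \<subseteq> V" using assms(1) unfolding fits_def by auto
  have s: "real s > 0" using assms(2) by (auto simp: nonfull_def)
  have C: "real (card C) < real r * real s"
    using card_less_if_nonfull[OF assms] by (metis of_nat_less_iff of_nat_mult)
  \<comment> \<open>With \<open>nonfull\<close> as target the inaccessible classes are full and the
    count is exact. Strictness comes from the missing vertex of class \<open>j\<close>.\<close>
  have "real ?a * (real r - real ?a) * real s = real ?a * real ((r - ?a) * s)"
    using card_compl_acc(2) by (simp add: of_nat_diff)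
  also have "\<dots> \<le> m2 * real (card C)"
    using acc_edge_count[OF pr CV] card_outside_nonfull[OF assms(1)] by metis
  also have "\<dots> < m2 * real r * real s" using C m2_pos by simp
  also have "\<dots> \<le> lo * hi * real s" using m2_r_le s by (simp add: mult_right_mono)
  finally show "real ?a * (real r - real ?a) < lo * hi" using s by simp
qed

text \<open>Class \<open>j\<close> dominates the \<open>(r - a) * s\<close> vertices outside the
  \<open>a\<close> accessible classes, so \<open>r - a < hi\<close>, that is \<open>lo < a\<close>.
  The dichotomy leaves only \<open>hi < a\<close>.\<close>

lemma low_class_acc:
  assumes "fits C f s" "j \<in> nonfull C f s" "degsum (cls C f j) < hi * s"
  shows "hi < card (acc C f (nonfull C f s))"
proof -
  let ?a = "card (acc C f (nonfull C f s))"
  have s: "real s > 0" using assms(2) by (auto simp: nonfull_def)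
  have "j \<in> acc C f (nonfull C f s)" using assms(2) acc_target by (auto simp: nonfull_def)
  then have "(r - ?a) * s \<le> degsum (cls C f j)"
    using outside_le_degsum card_outside_nonfull[OF assms(1)] assms(1)
    unfolding fits_def by metis
  then have "real ((r - ?a) * s) \<le> real (degsum (cls C f j))" by (simp only: of_nat_le_iff)
  then have "(real r - real ?a) * real s < hi * real s"
    using assms(3) card_compl_acc(2) by (simp add: of_nat_diff)
  then have "real r - real ?a < hi" using s by simp
  then have "lo < ?a" using lo_plus_hi by linarith
  then show ?thesis using acc_dichotomy[OF assms(1,2)] by linarith
qed

text \<open>A low nonfull class makes more than \<open>hi\<close> classes accessible, whichever vertex is left
  uncolored. If the uncolored vertex cannot be placed, it can be exchanged with each neighbor that is
  its only neighbour in an accessible class. The vertices that can become uncolored in this way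
  therefore induce a graph of minimum degree above \<open>2 m1\<close>.\<close>

lemma place_any:
  assumes "1 \<le> lo" and fits: "fits C f s" and w: "w \<in> V" "w \<notin> C"
    and Y: "Y \<in> nonfull C f s" "degsum (cls C f Y) < hi * s"
  shows "\<exists>g j. j \<in> nonfull C f s \<and> proper (insert w C) g \<and>
     (\<forall>k. card (cls (insert w C) g k) = card (cls C f k) + (if k = j then 1 else 0))"
proof (rule ccontr)
  assume stuck: "\<not> ?thesis"
  define D where "D = insert w C"
  \<comment> \<open>Here \<open>u\<close> is the uncolored vertex. The class sizes and the class
    \<open>Y\<close> stay as under \<open>f\<close>, so \<open>low_class_acc\<close> applies in
    every state.\<close>
  define state where "state u g \<longleftrightarrow> u \<in> D \<and> proper (D - {u}) g \<and>
    (\<forall>i. card (cls (D - {u}) g i) = card (cls C f i)) \<and> cls (D - {u}) g Y = cls C f Y" for u g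
  define R where "R = {u. \<exists>g. state u g}"
  have DV: "D \<subseteq> V" and finD: "finite D" and RD: "R \<subseteq> D"
    using fits w finite_subset[OF _ finite_V] unfolding D_def fits_def R_def state_def by auto
  have "state w f" using fits w unfolding state_def D_def fits_def by auto
  then have "R \<noteq> {}" unfolding R_def by auto
  have deg: "2 * m1 < nb adj u R" if uR: "u \<in> R" for u
  proof -
    obtain g where g: "state u g" using uR unfolding R_def by auto
    have uD: "u \<in> D" and pr: "proper (D - {u}) g"
      and sz: "\<And>i. card (cls (D - {u}) g i) = card (cls C f i)"
      and clsY: "cls (D - {u}) g Y = cls C f Y" using g unfolding state_def by auto
    let ?M = "nonfull C f s"
    have M: "nonfull (D - {u}) g s = ?M" using sz unfolding nonfull_def by simp
    have fits': "fits (D - {u}) g s" using fits sz pr DV unfolding fits_def by auto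
    let ?A = "acc (D - {u}) g ?M"
    have hiA: "hi < card ?A"
      using low_class_acc[OF fits', of Y] Y clsY unfolding M by simp
    have YA: "Y \<in> ?A" using Y(1) acc_target by (auto simp: nonfull_def)
    \<comment> \<open>A free accessible class would let \<open>place\<close> color \<open>u\<close>;
      as the class sizes agree with those under \<open>f\<close>, this is what \<open>stuck\<close>
      excludes.\<close>
    have hit: "\<not> free (D - {u}) g u k" if k: "k \<in> ?A" for k
    proof
      assume fr: "free (D - {u}) g u k"
      have "?M \<subseteq> {..<r}" by (auto simp: nonfull_def)
      from place[OF pr _ k fr _ this] finD obtain g' j where
        "j \<in> ?M" "proper (insert u (D - {u})) g'"
        "\<And>k. card (cls (insert u (D - {u})) g' k) = card (cls (D - {u}) g k) + (if k = j then 1 else 0)"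
        by (metis Diff_iff finite_Diff insertCI)
      moreover have "insert u (D - {u}) = insert w C" using uD D_def by auto
      ultimately show False using stuck sz by metis
    qed
    define n where "n k = nb adj u (cls (D - {u}) g k)" for k
    have n1: "1 \<le> n k" if "k \<in> ?A" for k
    proof -
      have "{v \<in> cls (D - {u}) g k. adj u v} \<noteq> {}" using hit[OF that] unfolding free_def by auto
      moreover have "finite {v \<in> cls (D - {u}) g k. adj u v}" using finD by (simp add: cls_def)
      ultimately show ?thesis unfolding n_def nb_def by (simp add: Suc_le_eq card_gt_0_iff)
    qed
    have "(\<Sum>k\<in>?A. n k) \<le> r"
    proof -
      have "(\<Sum>k\<in>?A. n k) = card (\<Union>k\<in>?A. {v \<in> cls (D - {u}) g k. adj u v})"
        unfolding n_def nb_def using finite_acc finD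
        by (intro card_UN_disjoint[symmetric]) (auto simp: cls_def)
      also have "\<dots> \<le> card {v \<in> V. adj u v}"
        using DV finite_V by (intro card_mono) (auto simp: cls_def)
      also have "\<dots> \<le> r" using nb_le[of u] uD DV unfolding nb_def by auto
      finally show ?thesis .
    qed
    define S where "S = {k \<in> ?A - {Y}. n k = 1}"
    \<comment> \<open>Each accessible class holds two neighbors of \<open>u\<close> or is counted in
      \<open>S\<close>. The extra 1 pays for \<open>Y\<close>, which may hold just one but must not
      take part in an exchange.\<close>
    have "2 * card ?A \<le> 1 + card S + (\<Sum>k\<in>?A. n k)"
    proof -
      have "(\<Sum>k\<in>?A - {Y}. 2) \<le> (\<Sum>k\<in>?A - {Y}. n k + (if n k = 1 then 1 else 0))"
      proof (rule sum_mono)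
        fix k assume "k \<in> ?A - {Y}"
        then have "1 \<le> n k" using n1 by blast
        then show "2 \<le> n k + (if n k = 1 then 1 else 0)" by auto
      qed
      also have "\<dots> = (\<Sum>k\<in>?A - {Y}. n k) + card S"
        unfolding sum.distrib S_def using finite_acc by (simp flip: sum.inter_filter)
      finally have "2 * card (?A - {Y}) \<le> (\<Sum>k\<in>?A - {Y}. n k) + card S" by simp
      moreover have "card ?A = Suc (card (?A - {Y}))" by (rule card.remove[OF finite_acc YA])
      moreover have "(\<Sum>k\<in>?A. n k) = n Y + (\<Sum>k\<in>?A - {Y}. n k)"
        by (rule sum.remove[OF finite_acc YA])
      ultimately show ?thesis using n1[OF YA] by linarith
    qed
    moreover have "card S \<le> nb adj u R"
    proof (rule card_le_nb)
      show "finite R" using RD finD by (rule finite_subset)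
      fix k assume k: "k \<in> S"
      then have "card {v \<in> cls (D - {u}) g k. adj u v} = 1" unfolding S_def n_def nb_def by auto
      then obtain v where v: "{v \<in> cls (D - {u}) g k. adj u v} = {v}" by (auto simp: card_1_singleton_iff)
      then have vD: "v \<in> D" "v \<noteq> u" "g v = k" "adj u v" by (auto simp: cls_def)
      have kY: "k \<noteq> Y" "k < r" using k acc_less S_def by auto
      \<comment> \<open>The exchange: \<open>u\<close> takes the place of \<open>v\<close>, its only
        neighbor in class \<open>k\<close>.\<close>
      define g' where "g' = g(u := k)"
      have ck: "cls (D - {v}) g' k = insert u (cls (D - {u}) g k - {v})"
        using vD uD by (auto simp: cls_def g'_def)
      have ci: "cls (D - {v}) g' i = cls (D - {u}) g i" if "i \<noteq> k" for i
        using vD uD that by (auto simp: cls_def g'_def)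
      have fk: "finite (cls (D - {u}) g k)" using finD by (simp add: cls_def)
      have "v \<in> cls (D - {u}) g k" using vD by (simp add: cls_def)
      then have "card (cls (D - {v}) g' k) = card (cls (D - {u}) g k)"
        unfolding ck using card.remove[OF fk, of v] fk by (simp add: cls_def)
      then have "card (cls (D - {v}) g' i) = card (cls C f i)" for i
        using ci[of i] sz by (cases "i = k") auto
      moreover have "proper (D - {v}) g'"
      proof -
        have "\<not> adj u z" if "z \<in> D" "z \<noteq> v" "z \<noteq> u" "g z = k" for z
          using v that by (auto simp: cls_def)
        then show ?thesis using pr kY adj_sym adj_irrefl unfolding proper_def g'_def by auto
      qed
      ultimately have "state v g'"
        using vD ci[of Y] clsY kY unfolding state_def by auto
      then have "v \<in> R" unfolding R_def by auto
      then show "\<exists>v\<in>cls R g k. adj u v" using vD by (auto simp: cls_def)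
    qed
    ultimately have "2 * card ?A \<le> 1 + nb adj u R + r" using \<open>(\<Sum>k\<in>?A. n k) \<le> r\<close> by linarith
    then have "2 * real (card ?A) \<le> 1 + real (nb adj u R) + real r" by linarith
    then show ?thesis using swap_degree_bound[OF assms(1)] hiA by linarith
  qed
  have "(\<Sum>u\<in>R. 2 * m1) < (\<Sum>u\<in>R. real (nb adj u R))"
    using deg \<open>R \<noteq> {}\<close> finite_subset[OF RD finD] by (intro sum_strict_mono) auto
  then show False using density[OF subset_trans[OF RD DV]] by (simp add: mult.commute)
qed

section \<open>Solo neighbors\<close>

text \<open>Otherwise the vertices of low classes whose only neighbor in the class \<open>i0\<close> is \<open>w\<close> form a
  clique for every \<open>w\<close>. These cliques, the classes of large degree sum and the edges leaving the
  accessible classes together exceed the degree sum allowed by \<open>m1\<close>.\<close>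

lemma solo_pair:
  assumes fits: "fits C f s" and V: "card V \<le> r * s" and s: "s > 0"
    and A: "A = acc C f (nonfull C f s)" and a: "a = card A" "real a < lo" and i0: "i0 \<in> A"
  shows "\<exists>w y1 y2. w \<in> cls C f i0 \<and> y1 \<in> C \<and> y2 \<in> C \<and> y1 \<noteq> y2 \<and> \<not> adj y1 y2 \<and>
    (\<forall>y\<in>{y1, y2}. f y \<notin> A \<and> degsum (cls C f (f y)) < (hi - a) * s \<and>
      {u\<in>cls C f i0. adj y u} = {w})"
proof (rule ccontr)
  assume contra: "\<not> ?thesis"
  let ?V1 = "cls C f i0"
  \<comment> \<open>The threshold \<open>(hi - a) * s\<close> has two purposes: it gives high and
    low classes the same weight \<open>hi\<close> in the final sum, and it leaves a reserve of
    \<open>a * s\<close> for a vertex added to the class later.\<close>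
  define L where "L = {i. i < r \<and> i \<notin> A \<and> degsum (cls C f i) < (hi - a) * s}"
  define H where "H = {..<r} - A - L"
  define LV where "LV = {v\<in>C. f v \<in> L}"
  define HV where "HV = {v\<in>C. f v \<in> H}"
  define solo where "solo w = {y\<in>LV. {u\<in>?V1. adj y u} = {w}}" for w
  define k where "k w = card (solo w)" for w
  have CV: "C \<subseteq> V" and pr: "proper C f" and le: "\<And>i. i < r \<Longrightarrow> card (cls C f i) \<le> s"
    using fits unfolding fits_def by auto
  have fin: "finite C" "finite ?V1" "finite LV" "finite HV" "finite L" "finite H" "finite A"
    "\<And>w. finite (solo w)"
    using finite_subset[OF CV finite_V] finite_acc
    unfolding cls_def LV_def HV_def L_def H_def A solo_def by auto
  have AL: "A \<subseteq> {..<r}" "L \<subseteq> {..<r} - A" using acc_less unfolding A L_def by auto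
  have a1: "1 \<le> a" using i0 fin(7) a(1) by (auto simp: Suc_le_eq card_gt_0_iff)
  have part: "a + card L + card H = r"
  proof -
    have "{..<r} = A \<union> L \<union> H" using AL unfolding H_def by auto
    moreover have "card (A \<union> L \<union> H) = a + card L + card H"
      unfolding a(1) using fin AL by (subst card_Un_disjoint, auto simp: H_def)+
    ultimately show ?thesis by (metis card_lessThan)
  qed
  have full: "card (cls C f i) = s" if "i < r" "i \<notin> A" for i
  proof -
    have "i \<notin> nonfull C f s" using that acc_target A by blast
    then show ?thesis using that le[of i] unfolding nonfull_def by auto
  qed
  have cLV: "card LV = card L * s"
  proof -
    have "card LV = (\<Sum>i\<in>L. s)" unfolding LV_def card_eq_sum_cls[OF fin(1,5)]
      using full AL by (intro sum.cong) auto
    then show ?thesis by simp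
  qed
  have cHV: "card HV = card H * s"
  proof -
    have "card HV = (\<Sum>i\<in>H. s)" unfolding HV_def card_eq_sum_cls[OF fin(1,6)]
      using full by (intro sum.cong) (auto simp: H_def)
    then show ?thesis by simp
  qed
  have dom: "\<exists>u\<in>cls C f i. adj y u" if "i \<in> A" "y \<in> LV \<union> HV" for i y
    using acc_dominates[of i C f "nonfull C f s" y] that AL unfolding A LV_def HV_def H_def by auto
  have solo_disj: "\<forall>w\<in>?V1. \<forall>w'\<in>?V1. w \<noteq> w' \<longrightarrow> solo w \<inter> solo w' = {}"
    unfolding solo_def by auto
  have clique: "adj y y'" if "w \<in> ?V1" "y \<in> solo w" "y' \<in> solo w" "y \<noteq> y'" for w y y'
  proof (rule ccontr)
    assume "\<not> adj y y'"
    moreover have "y \<in> C" "y' \<in> C" using that unfolding solo_def LV_def by auto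
    moreover have "\<forall>z\<in>{y, y'}. f z \<notin> A \<and> degsum (cls C f (f z)) < (hi - a) * s \<and>
        {u\<in>?V1. adj z u} = {w}"
      using that unfolding solo_def LV_def L_def by auto
    ultimately show False using contra that(1,4) by blast
  qed
  have degA: "a * ((r - a) * s) \<le> (\<Sum>i\<in>A. degsum (cls C f i))"
  proof -
    have "(\<Sum>i\<in>A. card (outside C f (nonfull C f s))) \<le> (\<Sum>i\<in>A. degsum (cls C f i))"
      using outside_le_degsum[OF pr CV] unfolding A by (intro sum_mono) auto
    then show ?thesis using card_outside_nonfull[OF fits] a(1) A by simp
  qed
  have degH: "card H * ((hi - a) * s) \<le> (\<Sum>i\<in>H. degsum (cls C f i))"
  proof -
    have "(\<Sum>i\<in>H. (hi - a) * s) \<le> (\<Sum>i\<in>H. real (degsum (cls C f i)))"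
      by (intro sum_mono) (auto simp: H_def L_def)
    then show ?thesis by simp
  qed
  \<comment> \<open>A vertex of a low class has \<open>a\<close> neighbors in accessible classes; a
    member of \<open>solo w\<close> has \<open>k w - 1\<close> further ones in its clique.\<close>
  have degL: "a * card LV + (\<Sum>w\<in>?V1. k w * (k w - 1)) \<le> (\<Sum>i\<in>L. degsum (cls C f i))"
  proof -
    have 1: "a + nb adj y LV \<le> nb adj y V" if y: "y \<in> LV" for y
    proof -
      have "a \<le> nb adj y {v\<in>C. f v \<in> A}"
        unfolding a(1)
      proof (rule card_le_nb)
        fix i assume i: "i \<in> A"
        then have "cls {v\<in>C. f v \<in> A} f i = cls C f i" by (auto simp: cls_def)
        then show "\<exists>u\<in>cls {v\<in>C. f v \<in> A} f i. adj y u" using dom[OF i] y by simp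
      qed (use fin in auto)
      moreover have "nb adj y {v\<in>C. f v \<in> A} + nb adj y LV = card ({u\<in>{v\<in>C. f v \<in> A}. adj y u} \<union> {u\<in>LV. adj y u})"
        unfolding nb_def using fin AL by (intro card_Un_disjoint[symmetric]) (auto simp: LV_def)
      moreover have "\<dots> \<le> nb adj y V" unfolding nb_def
        using CV finite_V by (intro card_mono) (auto simp: LV_def)
      ultimately show ?thesis by linarith
    qed
    have 2: "k w - 1 \<le> nb adj y LV" if w: "w \<in> ?V1" and y: "y \<in> solo w" for w y
    proof -
      have "card (solo w - {y}) \<le> nb adj y LV" unfolding nb_def
        using clique[OF w y] fin by (intro card_mono) (auto simp: solo_def)
      then show ?thesis using y fin by (simp add: k_def)
    qed
    have "(\<Sum>w\<in>?V1. k w * (k w - 1)) \<le> (\<Sum>w\<in>?V1. \<Sum>y\<in>solo w. nb adj y LV)"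
    proof (rule sum_mono)
      fix w assume "w \<in> ?V1"
      then have "(\<Sum>y\<in>solo w. k w - 1) \<le> (\<Sum>y\<in>solo w. nb adj y LV)" using 2 by (intro sum_mono) auto
      then show "k w * (k w - 1) \<le> (\<Sum>y\<in>solo w. nb adj y LV)" by (simp add: k_def)
    qed
    also have "\<dots> = (\<Sum>y\<in>(\<Union>w\<in>?V1. solo w). nb adj y LV)"
      using fin solo_disj by (intro sum.UNION_disjoint[symmetric]) auto
    also have "\<dots> \<le> (\<Sum>y\<in>LV. nb adj y LV)" using fin by (intro sum_mono2) (auto simp: solo_def)
    finally have "a * card LV + (\<Sum>w\<in>?V1. k w * (k w - 1)) \<le> (\<Sum>y\<in>LV. a + nb adj y LV)"
      by (simp add: sum.distrib)
    also have "\<dots> \<le> (\<Sum>y\<in>LV. nb adj y V)" using 1 by (intro sum_mono)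
    finally show ?thesis unfolding sum_degsum[OF fin(1,5)] LV_def .
  qed
  have total: "real (\<Sum>i<r. degsum (cls C f i)) \<le> 2 * m1 * r * s"
  proof -
    have "(\<Sum>i<r. degsum (cls C f i)) \<le> (\<Sum>v\<in>V. nb adj v V)"
      unfolding sum_degsum[OF fin(1) finite_lessThan] using finite_V CV by (intro sum_mono2) auto
    then have "real (\<Sum>i<r. degsum (cls C f i)) \<le> 2 * m1 * real (card V)"
      using density[OF subset_refl] by linarith
    also have "\<dots> \<le> 2 * m1 * real (r * s)"
      using V m1_pos by (intro mult_left_mono) (auto simp del: of_nat_mult)
    finally show ?thesis by simp
  qed
  have split: "(\<Sum>i<r. degsum (cls C f i)) =
      (\<Sum>i\<in>A. degsum (cls C f i)) + (\<Sum>i\<in>H. degsum (cls C f i)) + (\<Sum>i\<in>L. degsum (cls C f i))"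
  proof -
    have "{..<r} = A \<union> H \<union> L" using AL unfolding H_def by auto
    moreover have "(\<Sum>i\<in>A \<union> H \<union> L. degsum (cls C f i)) =
      (\<Sum>i\<in>A. degsum (cls C f i)) + (\<Sum>i\<in>H. degsum (cls C f i)) + (\<Sum>i\<in>L. degsum (cls C f i))"
      using fin AL by (subst sum.union_disjoint, auto simp: H_def)+
    ultimately show ?thesis by simp
  qed
  \<comment> \<open>Count the edges at class \<open>i0\<close>: a low vertex sends two unless it is
    solo, a high vertex sends one, and at most \<open>s\<close> vertices of degree at most
    \<open>r\<close> receive them.\<close>
  have soloq: "2 * card LV + card HV \<le> (\<Sum>w\<in>?V1. k w) + r * s"
  proof -
    let ?SS = "\<Union>w\<in>?V1. solo w"
    have SS: "?SS \<subseteq> LV" unfolding solo_def by auto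
    have q: "(\<Sum>w\<in>?V1. k w) = card ?SS"
      unfolding k_def using fin solo_disj by (intro card_UN_disjoint[symmetric]) auto
    have "2 \<le> nb adj y ?V1 + (if y \<in> ?SS then 1 else 0)" if y: "y \<in> LV" for y
    proof -
      let ?N = "{u\<in>?V1. adj y u}"
      have "?N \<noteq> {}" using dom[OF i0, of y] y by auto
      then have c: "card ?N \<noteq> 0" using fin by simp
      show ?thesis
      proof (cases "card ?N = 1")
        case True
        then obtain w where w: "?N = {w}" by (auto simp: card_1_singleton_iff)
        then have "y \<in> solo w" "w \<in> ?V1" using y unfolding solo_def by auto
        then have "y \<in> ?SS" by auto
        then show ?thesis using True unfolding nb_def by simp
      next
        case False
        then show ?thesis using c unfolding nb_def by simp
      qed
    qed
    then have "(\<Sum>y\<in>LV. 2) \<le> (\<Sum>y\<in>LV. nb adj y ?V1 + (if y \<in> ?SS then 1 else 0))"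
      by (intro sum_mono)
    also have "\<dots> = (\<Sum>y\<in>LV. nb adj y ?V1) + card {y\<in>LV. y \<in> ?SS}"
      unfolding sum.distrib using fin by (simp flip: sum.inter_filter)
    also have "{y\<in>LV. y \<in> ?SS} = ?SS" using SS by auto
    finally have l: "2 * card LV \<le> (\<Sum>y\<in>LV. nb adj y ?V1) + card ?SS" by simp
    have "(\<Sum>y\<in>HV. 1) \<le> (\<Sum>y\<in>HV. nb adj y ?V1)"
    proof (rule sum_mono)
      fix y assume "y \<in> HV"
      then have "{u\<in>?V1. adj y u} \<noteq> {}" using dom[OF i0, of y] by auto
      then show "1 \<le> nb adj y ?V1" unfolding nb_def using fin by (simp add: Suc_le_eq card_gt_0_iff)
    qed
    then have h: "card HV \<le> (\<Sum>y\<in>HV. nb adj y ?V1)" by simp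
    have "(\<Sum>y\<in>LV. nb adj y ?V1) + (\<Sum>y\<in>HV. nb adj y ?V1) = (\<Sum>y\<in>LV \<union> HV. nb adj y ?V1)"
      using fin by (intro sum.union_disjoint[symmetric]) (auto simp: LV_def HV_def H_def)
    also have "\<dots> = (\<Sum>u\<in>?V1. nb adj u (LV \<union> HV))" using fin by (intro sum_nb_swap) auto
    also have "\<dots> \<le> (\<Sum>u\<in>?V1. r)"
    proof (rule sum_mono)
      fix u assume "u \<in> ?V1"
      then have "u \<in> V" using CV by (auto simp: cls_def)
      moreover have "nb adj u (LV \<union> HV) \<le> nb adj u V"
        using CV finite_V by (intro nb_mono) (auto simp: LV_def HV_def)
      ultimately show "nb adj u (LV \<union> HV) \<le> r" using nb_le[of u] by linarith
    qed
    also have "\<dots> \<le> r * s" using le[of i0] i0 AL by (auto simp: mult.commute)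
    finally show ?thesis using l h q by linarith
  qed
  \<comment> \<open>Tangent point for \<open>k\<^sup>2\<close>, chosen so that \<open>card L\<close> cancels from the final inequality.\<close>
  define j where "j = (hi - 2 * a + 1) / 2"
  have hia: "hi - 2 * a \<ge> 0" using a(2) lo_le hi_ge by linarith
  have conv: "(hi - 2 * a) * (\<Sum>w\<in>?V1. real (k w)) - s * j^2 \<le> (\<Sum>w\<in>?V1. real (k w * (k w - 1)))"
  proof -
    \<comment> \<open>This is \<open>(k w - j)^2 \<ge> 0\<close>, rewritten with
      \<open>hi - 2 * a = 2 * j - 1\<close>.\<close>
    have "(hi - 2 * a) * real (k w) - j^2 \<le> real (k w * (k w - 1))" for w
    proof -
      have "real (k w * (k w - 1)) = real (k w)^2 - real (k w)"
        by (cases "k w") (auto simp: power2_eq_square algebra_simps)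
      moreover have "0 \<le> (real (k w) - j)^2" by simp
      moreover have hij: "hi - 2 * a = 2 * j - 1" unfolding j_def by (simp add: field_simps)
      ultimately show ?thesis unfolding hij by (simp add: power2_eq_square algebra_simps)
    qed
    then have "(\<Sum>w\<in>?V1. (hi - 2 * a) * real (k w) - j^2) \<le> (\<Sum>w\<in>?V1. real (k w * (k w - 1)))"
      by (intro sum_mono)
    moreover have "(\<Sum>w\<in>?V1. (hi - 2 * a) * real (k w) - j^2) =
        (hi - 2 * a) * (\<Sum>w\<in>?V1. real (k w)) - real (card ?V1) * j^2"
      by (simp add: sum_subtractf sum_distrib_left)
    moreover have "real (card ?V1) * j^2 \<le> s * j^2"
      using le[of i0] i0 AL by (intro mult_right_mono) auto
    ultimately show ?thesis by linarith
  qed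
  define l h :: real where "l = card L" and "h = card H"
  have rr: "real r = a + l + h" using part unfolding l_def h_def by linarith
  have "2 * (l * s) + h * s \<le> (\<Sum>w\<in>?V1. real (k w)) + real r * s"
  proof -
    have "real (2 * card LV + card HV) \<le> real ((\<Sum>w\<in>?V1. k w) + r * s)"
      using soloq by (simp only: of_nat_le_iff)
    then show ?thesis unfolding cLV cHV l_def h_def by simp
  qed
  then have "(l - a) * s \<le> (\<Sum>w\<in>?V1. real (k w))" unfolding rr by (simp add: algebra_simps)
  then have "(hi - 2 * a) * ((l - a) * s) \<le> (hi - 2 * a) * (\<Sum>w\<in>?V1. real (k w))"
    using hia by (rule mult_left_mono)
  then have dL: "a * (l * s) + (hi - 2 * a) * ((l - a) * s) - s * j^2 \<le> real (\<Sum>i\<in>L. degsum (cls C f i))"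
  proof -
    have "real (a * card LV + (\<Sum>w\<in>?V1. k w * (k w - 1))) \<le> real (\<Sum>i\<in>L. degsum (cls C f i))"
      using degL by (simp only: of_nat_le_iff)
    then have "a * (l * s) + (\<Sum>w\<in>?V1. real (k w * (k w - 1))) \<le> real (\<Sum>i\<in>L. degsum (cls C f i))"
      unfolding cLV l_def by simp
    with conv \<open>(hi - 2 * a) * ((l - a) * s) \<le> _\<close> show ?thesis by linarith
  qed
  have dA: "a * ((l + h) * s) \<le> real (\<Sum>i\<in>A. degsum (cls C f i))"
  proof -
    have "r - a = card L + card H" using part by linarith
    then have "real (a * ((card L + card H) * s)) \<le> real (\<Sum>i\<in>A. degsum (cls C f i))"
      using degA by (simp only: of_nat_le_iff)
    then show ?thesis unfolding l_def h_def by simp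
  qed
  have dH: "h * ((hi - a) * s) \<le> real (\<Sum>i\<in>H. degsum (cls C f i))" using degH unfolding h_def by simp
  have "a * ((l + h) * s) + h * ((hi - a) * s) + (a * (l * s) + (hi - 2 * a) * ((l - a) * s) - s * j^2)
      \<le> 2 * m1 * r * s"
    using total dA dH dL unfolding split of_nat_add by linarith
  \<comment> \<open>Both \<open>l\<close> and \<open>h\<close> have coefficient
    \<open>hi * s\<close>, so only their sum \<open>r - a\<close> matters.\<close>
  moreover have "a * ((l + h) * s) + h * ((hi - a) * s) + (a * (l * s) + (hi - 2 * a) * ((l - a) * s) - s * j^2)
      = ((r - 2 * real a) * hi + 2 * real a^2 - j^2) * s"
    unfolding rr by (simp add: algebra_simps power2_eq_square)
  moreover have "2 * m1 * r * s < ((r - 2 * real a) * hi + 2 * real a^2 - j^2) * s"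
    using counting_bound[of "real a"] a1 a(2) s unfolding j_def by (intro mult_strict_right_mono) auto
  ultimately show False by linarith
qed

section \<open>Extending a balanced coloring\<close>

text \<open>For the case that both moved vertices leave the same class \<open>Y\<close>, which must
  then be refilled first; hence the target \<open>{Y}\<close>. Other inaccessible classes may have
  \<open>s - 1\<close> vertices, so the counts carry an error, kept below \<open>a\<close> by the
  hypothesis \<open>small\<close>.\<close>

lemma place_in_emptied_class:
  assumes fits: "fits D g s" and Y: "Y < r" and x: "real (nb adj x V) \<le> 2 * m1"
    and low: "degsum (cls D g Y) < (hi - a) * s"
    and small: "card (nonfull D g s - {Y}) < a"
    and near: "\<And>i. i < r \<Longrightarrow> i \<noteq> Y \<Longrightarrow> s \<le> card (cls D g i) + 1"
    and a: "real a < lo" "r \<le> a * s"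
  obtains i where "i \<in> acc D g {Y}" "free D g x i"
proof (rule free_acc_class)
  have DV: "D \<subseteq> V" and pr: "proper D g" and le: "\<And>i. i < r \<Longrightarrow> card (cls D g i) \<le> s"
    using fits unfolding fits_def by auto
  show fin: "finite D" using DV finite_V by (rule finite_subset)
  let ?A = "acc D g {Y}"
  define a' where "a' = card ?A"
  define q where "q = card (outside D g {Y})"
  have a'r: "a' \<le> r" unfolding a'_def by (rule card_compl_acc)
  have YA: "Y \<in> ?A" using Y acc_target by auto
  \<comment> \<open>An inaccessible class is not \<open>Y\<close>, so it lacks at most one vertex,
    and only if it is nonfull.\<close>
  have "(r - a') * s \<le> q + card (nonfull D g s - {Y})"
  proof -
    let ?B = "{..<r} - ?A"
    have "(\<Sum>i\<in>?B. s) \<le> (\<Sum>i\<in>?B. card (cls D g i) + (if i \<in> nonfull D g s then 1 else 0))"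
    proof (rule sum_mono)
      fix i assume i: "i \<in> ?B"
      then have "i \<noteq> Y" using YA by auto
      then show "s \<le> card (cls D g i) + (if i \<in> nonfull D g s then 1 else 0)"
        using near[of i] i by (auto simp: nonfull_def)
    qed
    also have "\<dots> = q + card {i\<in>?B. i \<in> nonfull D g s}"
      unfolding sum.distrib q_def card_outside[OF pr fin] by (simp flip: sum.inter_filter)
    also have "card {i\<in>?B. i \<in> nonfull D g s} \<le> card (nonfull D g s - {Y})"
      using YA by (intro card_mono) (auto simp: nonfull_def)
    finally show ?thesis using card_compl_acc(1)[of D g "{Y}"] unfolding a'_def by simp
  qed
  then have "(r - a') * s + 1 \<le> q + a" using small by linarith
  then have "real ((r - a') * s + 1) \<le> real (q + a)" by (simp only: of_nat_le_iff)
  then have q1: "(real r - a') * s + 1 \<le> real q + a" using a'r by (simp add: of_nat_diff)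
  have "q \<le> degsum (cls D g Y)" unfolding q_def by (rule outside_le_degsum[OF pr DV YA])
  then have q2: "real q < (hi - a) * s" using low by linarith
  have dm: "card D \<le> r * s"
  proof -
    have "card D \<le> (\<Sum>i<r. s)" unfolding card_proper[OF pr fin] using le by (intro sum_mono) auto
    then show ?thesis by simp
  qed
  have q3: "real a' * real q \<le> lo * hi * s"
  proof -
    have "real a' * real q \<le> m2 * real (card D)"
      unfolding a'_def q_def by (rule acc_edge_count[OF pr DV])
    also have "\<dots> \<le> m2 * (real r * real s)"
      using dm m2_pos by (intro mult_left_mono) (auto simp flip: of_nat_mult)
    also have "\<dots> \<le> lo * hi * s" using mult_right_mono[OF m2_r_le, of s] by (simp add: mult.assoc)
    finally show ?thesis .
  qed
  have r: "real r > 0" using r_pos by simp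
  show "nb adj x D < card ?A"
  proof (rule ccontr)
    assume "\<not> ?thesis"
    then have "a' \<le> nb adj x D" unfolding a'_def by simp
    also have "\<dots> \<le> nb adj x V" using DV finite_V by (rule nb_mono)
    finally have "real a' \<le> real r / 2" using x m1_le_half by linarith
    then have gap: "real r / 4 \<le> hi - a'" using hi_ge by linarith
    have a0: "0 < real a" using a(2) r_pos by (cases a) auto
    have as: "real r \<le> real a * real s" using a(2) by (metis of_nat_le_iff of_nat_mult)
    \<comment> \<open>From \<open>r \<le> a * s\<close> and
      \<open>a < lo \<le> r / 4\<close>.\<close>
    have s4: "4 < real s"
    proof (rule ccontr)
      assume "\<not> ?thesis"
      then have "real a * real s \<le> real a * 4" by (intro mult_left_mono) auto
      then show False using as a(1) lo_le by linarith
    qed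
    have hilo: "real r - hi = lo" "real r = lo + hi" using lo_plus_hi by linarith+
    \<comment> \<open>The small degree sum of \<open>Y\<close> pushes \<open>a'\<close> well above
      \<open>lo\<close> (\<open>A\<close>), while the bipartite edge count keeps it near
      \<open>lo\<close> (\<open>B\<close>). After multiplying \<open>A\<close> by
      \<open>hi - a'\<close>, which is at least \<open>r / 4\<close>, the two yield
      \<open>3/4 * a * r \<le> 1/2 * a * r\<close>.\<close>
    have "(real r - a') * s + 1 < (hi - a) * s + a" using q1 q2 by linarith
    then have A: "real a * (real s - 1) < (real a' - lo) * s"
      unfolding hilo(1)[symmetric] by (simp add: algebra_simps)
    have "real a' * ((real r - a') * s + 1 - a) \<le> real a' * real q"
      using q1 by (intro mult_left_mono) auto
    then have B: "(a' - lo) * s * (hi - a') \<le> real a' * (real a - 1)"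
      using q3 unfolding hilo(2) by (simp add: algebra_simps)
    have "(real a * (real s - 1)) * (hi - a') \<le> (a' - lo) * s * (hi - a')"
      using A gap r by (intro mult_right_mono) auto
    moreover have "(real a * 3) * (r / 4) \<le> (real a * (real s - 1)) * (hi - a')"
      using s4 gap a0 r by (intro mult_mono mult_left_mono) auto
    moreover have "real a' * (real a - 1) \<le> (r / 2) * real a"
      using \<open>real a' \<le> real r / 2\<close> a0 a(2) r_pos by (intro mult_mono) auto
    ultimately have "(real a * 3) * (r / 4) \<le> (r / 2) * real a" using B by linarith
    moreover have "0 < real a * r" using a0 r by simp
    ultimately show False by (simp add: field_simps)
  qed
qed

text \<open>The sizes allowed are \<open>s - 1\<close> and \<open>s\<close>, so a coloring with all
  classes of size \<open>s\<close> is balanced for \<open>s + 1\<close> as well.\<close>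

definition balanced :: "'a set \<Rightarrow> ('a \<Rightarrow> nat) \<Rightarrow> nat \<Rightarrow> bool" where
  "balanced C f s \<longleftrightarrow> proper C f \<and> (\<forall>i<r. card (cls C f i) \<le> s \<and> s \<le> card (cls C f i) + 1)"

text \<open>If no accessible class is free for \<open>x\<close>, the pair from
  \<open>solo_pair\<close> replaces \<open>w\<close>, and \<open>x\<close> and \<open>w\<close> are
  placed in this order. The cases differ in whether \<open>y1\<close> and \<open>y2\<close> come
  from distinct classes.\<close>

lemma extend_balanced:
  assumes x: "x \<in> V" "real (nb adj x V) \<le> 2 * m1"
    and bal: "balanced (V - {x}) f s" and i0: "i0 \<in> nonfull (V - {x}) f s"
  shows "\<exists>g. balanced V g s"
proof (cases "\<exists>i\<in>acc (V - {x}) f (nonfull (V - {x}) f s). free (V - {x}) f x i")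
  case True
  then obtain i where i: "i \<in> acc (V - {x}) f (nonfull (V - {x}) f s)" "free (V - {x}) f x i" by blast
  have M: "nonfull (V - {x}) f s \<subseteq> {..<r}" by (auto simp: nonfull_def)
  have pr: "proper (V - {x}) f" using bal unfolding balanced_def by simp
  have ins: "insert x (V - {x}) = V" using x by auto
  obtain g j z where g: "j \<in> nonfull (V - {x}) f s" "proper V g"
    "\<And>k. card (cls V g k) = card (cls (V - {x}) f k) + (if k = j then 1 else 0)"
    by (rule place[OF pr _ i _ M, unfolded ins]) (use finite_V in auto)
  then have "balanced V g s" using bal unfolding balanced_def nonfull_def by auto
  then show ?thesis by blast
next
  case False
  define C where "C = V - {x}"
  define A where "A = acc C f (nonfull C f s)"
  define a where "a = card A"
  have CV: "C \<subseteq> V" and xC: "x \<notin> C" and pr: "proper C f"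
    and sz: "\<And>i. i < r \<Longrightarrow> card (cls C f i) \<le> s \<and> s \<le> card (cls C f i) + 1"
    using bal unfolding C_def balanced_def by auto
  have i0C: "i0 \<in> nonfull C f s" "i0 < r" using i0 unfolding C_def nonfull_def by auto
  have finC: "finite C" using CV finite_V by (rule finite_subset)
  have fits: "fits C f s" using CV pr sz unfolding fits_def by auto
  have i0A: "i0 \<in> A" unfolding A_def using i0C acc_target by auto
  have rpos: "real r > 0" using r_pos by simp
  have a_lo: "real a < lo"
  proof -
    have "a \<le> nb adj x C"
    proof (rule ccontr)
      assume "\<not> ?thesis"
      then have "nb adj x C < card (acc C f (nonfull C f s))" unfolding a_def A_def by simp
      then obtain i where "i \<in> acc C f (nonfull C f s)" "free C f x i"
        using free_acc_class[OF finC] by blast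
      then show False using False unfolding C_def by blast
    qed
    also have "\<dots> \<le> nb adj x V" using CV finite_V by (rule nb_mono)
    finally have "real a \<le> r / 2" using x(2) m1_le_half by linarith
    then have "\<not> hi < a" using hi_ge rpos by linarith
    then show ?thesis using acc_dichotomy[OF fits i0C(1)] unfolding a_def A_def by blast
  qed
  have a1: "1 \<le> a" using i0A finite_acc unfolding a_def A_def by (auto simp: Suc_le_eq card_gt_0_iff)
  have lo1: "1 \<le> lo" using a1 a_lo by linarith
  have cV: "card V \<le> r * s"
  proof -
    have "card V = Suc (card C)" unfolding C_def by (rule card.remove[OF finite_V x(1)])
    then show ?thesis using card_less_if_nonfull[OF fits i0C(1)] by linarith
  qed
  have s0: "s > 0" using i0C by (auto simp: nonfull_def)
  have c0: "card (cls C f i0) + 1 = s" using i0C sz[of i0] by (auto simp: nonfull_def)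
  \<comment> \<open>Class \<open>i0\<close> has \<open>s - 1\<close> vertices of degree at most
    \<open>r\<close> and dominates \<open>(r - a) * s\<close> vertices.\<close>
  have ras: "r \<le> a * s"
  proof -
    have "(r - a) * s \<le> degsum (cls C f i0)"
      using outside_le_degsum[OF pr CV] card_outside_nonfull[OF fits] i0A unfolding A_def a_def by metis
    also have "\<dots> \<le> (\<Sum>u\<in>cls C f i0. r)" unfolding degsum_def
      using nb_le CV by (intro sum_mono) (auto simp: cls_def)
    finally have "(r - a) * s \<le> card (cls C f i0) * r" by simp
    then have "(r - a) * s + r \<le> (card (cls C f i0) + 1) * r" by simp
    then have "(r - a) * s + r \<le> r * s" unfolding c0 by (simp add: mult.commute)
    moreover have "(r - a) * s + a * s = r * s"
      using card_compl_acc(2)[of C f "nonfull C f s"] unfolding a_def A_def by (simp flip: distrib_right)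
    ultimately show ?thesis by linarith
  qed
  obtain w y1 y2 where w: "w \<in> cls C f i0" and y: "y1 \<in> C" "y2 \<in> C" "y1 \<noteq> y2" "\<not> adj y1 y2"
    and both: "\<forall>y\<in>{y1, y2}. f y \<notin> A \<and> degsum (cls C f (f y)) < (hi - a) * s \<and>
      {u\<in>cls C f i0. adj y u} = {w}"
    using solo_pair[OF fits cV s0 A_def a_def a_lo i0A] by blast
  have yA: "f y1 \<notin> A" "f y2 \<notin> A"
    and low: "degsum (cls C f (f y1)) < (hi - a) * s" "degsum (cls C f (f y2)) < (hi - a) * s"
    and solo: "{u\<in>cls C f i0. adj y1 u} = {w}" "{u\<in>cls C f i0. adj y2 u} = {w}"
    using both by simp_all
  have wC: "w \<in> C" "f w = i0" using w by (auto simp: cls_def)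
  have yi: "f y1 \<noteq> i0" "f y2 \<noteq> i0" "f y1 < r" "f y2 < r"
    using yA i0A y pr unfolding proper_def by auto
  have wy: "w \<noteq> y1" "w \<noteq> y2" using wC yi by auto
  define D where "D = C - {w}"
  define g where "g = f(y1 := i0, y2 := i0)"
  have DV: "D \<subseteq> V" and finD: "finite D" and xD: "x \<notin> D" and wD: "w \<notin> insert x D" and wV: "w \<in> V"
    using CV finC xC wC unfolding D_def by auto
  have V_eq: "insert w (insert x D) = V" using wC x unfolding D_def C_def by auto
  have clsi0: "cls D g i0 = insert y1 (insert y2 (cls C f i0 - {w}))"
    using y wy unfolding cls_def D_def g_def by auto
  have clsi: "cls D g i = cls C f i - {y1, y2}" if "i \<noteq> i0" for i
    using that y wy wC unfolding cls_def D_def g_def by auto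
  have fcls: "finite (cls C f i)" for i using finC by (simp add: cls_def)
  \<comment> \<open>One vertex leaves and two enter a class of size \<open>s - 1\<close>.\<close>
  have cardi0: "card (cls D g i0) = s"
  proof -
    have "y1 \<notin> cls C f i0" "y2 \<notin> cls C f i0" using yi by (auto simp: cls_def)
    then show ?thesis unfolding clsi0 using fcls[of i0] y(3) card.remove[OF fcls w] c0 by simp
  qed
  have cardi: "card (cls D g i) = card (cls C f i)" if "i \<noteq> i0" "i \<noteq> f y1" "i \<noteq> f y2" for i
  proof -
    have "cls C f i - {y1, y2} = cls C f i" using that by (auto simp: cls_def)
    then show ?thesis using clsi[OF that(1)] by simp
  qed
  have fullY: "card (cls C f (f y1)) = s" "card (cls C f (f y2)) = s"
  proof -
    have "card (cls C f i) = s" if "i \<notin> A" "i < r" for i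
    proof -
      have "i \<notin> nonfull C f s" using that acc_target unfolding A_def by blast
      then show ?thesis using that sz[of i] by (simp add: nonfull_def)
    qed
    then show "card (cls C f (f y1)) = s" "card (cls C f (f y2)) = s" using yA yi by blast+
  qed
  have prD: "proper D g"
  proof -
    have n1: "\<not> adj y1 z" if "z \<in> D" "f z = i0" for z using solo(1) that unfolding D_def cls_def by auto
    have n2: "\<not> adj y2 z" if "z \<in> D" "f z = i0" for z using solo(2) that unfolding D_def cls_def by auto
    have "g v < r" if "v \<in> D" for v using that pr i0C unfolding proper_def D_def g_def by auto
    moreover have "g u \<noteq> g v" if "u \<in> D" "v \<in> D" "adj u v" for u v
    proof
      assume eq: "g u = g v"
      have uv: "u \<noteq> v" using that(3) adj_irrefl by auto
      have fuv: "f u \<noteq> f v" using pr that unfolding proper_def D_def by blast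
      show False
      proof (cases "g u = i0")
        case True
        then have "u \<in> {y1, y2} \<or> f u = i0" "v \<in> {y1, y2} \<or> f v = i0"
          using eq unfolding g_def by (auto split: if_splits)
        then show False using fuv n1[OF that(2)] n2[OF that(2)] n1[OF that(1)] n2[OF that(1)]
            that(3) uv y(4) adj_sym[OF that(3)] by auto
      next
        case False
        then have "f u = f v" using eq unfolding g_def by (auto split: if_splits)
        then show False using fuv by simp
      qed
    qed
    ultimately show ?thesis unfolding proper_def by blast
  qed
  have leD: "card (cls D g i) \<le> s" if "i < r" for i
  proof (cases "i = i0")
    case False
    then have "card (cls D g i) \<le> card (cls C f i)" using clsi fcls by (simp add: card_mono)
    then show ?thesis using sz[OF that] by linarith
  qed (simp add: cardi0)
  have fitsD: "fits D g s" using DV prD leD unfolding fits_def by auto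
  have xdeg: "nb adj x D \<le> nb adj x V" using DV finite_V by (rule nb_mono)
  \<comment> \<open>Once \<open>x\<close> is colored, a nonfull class of small degree sum is enough
    to place \<open>w\<close>.\<close>
  have finish: "\<exists>g. balanced V g s"
    if g': "fits (insert x D) g' s" and Y: "Y \<in> nonfull (insert x D) g' s"
      and l: "degsum (cls (insert x D) g' Y) < hi * s"
      and near: "\<And>i. i < r \<Longrightarrow> s \<le> card (cls (insert x D) g' i) + 1" for g' Y
  proof -
    obtain h j where h: "j \<in> nonfull (insert x D) g' s" "proper V h"
      "\<forall>k. card (cls V h k) = card (cls (insert x D) g' k) + (if k = j then 1 else 0)"
      using place_any[OF lo1 g' wV wD Y l] unfolding V_eq by blast
    have "card (cls V h i) \<le> s \<and> s \<le> card (cls V h i) + 1" if "i < r" for i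
      using h(1,3) near[OF that] g' that by (auto simp: fits_def nonfull_def)
    then have "balanced V h s" using h(2) unfolding balanced_def by blast
    then show ?thesis by blast
  qed
  have hia: "(hi - a) * s \<le> hi * s" by (simp add: mult_right_mono)
  have dlow: "degsum (cls D g (f y1)) < (hi - a) * s" "degsum (cls D g (f y2)) < (hi - a) * s"
  proof -
    have "degsum (cls D g (f y1)) \<le> degsum (cls C f (f y1))" "degsum (cls D g (f y2)) \<le> degsum (cls C f (f y2))"
      using clsi yi fcls by (auto intro!: degsum_mono)
    then show "degsum (cls D g (f y1)) < (hi - a) * s" "degsum (cls D g (f y2)) < (hi - a) * s"
      using low by linarith+
  qed
  show ?thesis
  proof (cases "f y1 = f y2")
    case False
    have cY: "card (cls D g (f y1)) + 1 = s" "card (cls D g (f y2)) + 1 = s"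
    proof -
      have "cls D g (f y1) = cls C f (f y1) - {y1}" "cls D g (f y2) = cls C f (f y2) - {y2}"
        using clsi yi False by (auto simp: cls_def)
      moreover have "y1 \<in> cls C f (f y1)" "y2 \<in> cls C f (f y2)" using y by (auto simp: cls_def)
      ultimately show "card (cls D g (f y1)) + 1 = s" "card (cls D g (f y2)) + 1 = s"
        using s0 fullY fcls by simp_all
    qed
    have M: "f y1 \<in> nonfull D g s" "f y2 \<in> nonfull D g s" "nonfull D g s \<subseteq> {..<r}"
      using cY yi unfolding nonfull_def by auto
    have "hi < card (acc D g (nonfull D g s))"
      using dlow(1) hia by (intro low_class_acc[OF fitsD M(1)]) linarith
    then have "nb adj x D < card (acc D g (nonfull D g s))"
      using xdeg x(2) m1_le_half hi_ge rpos by linarith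
    then obtain i where i: "i \<in> acc D g (nonfull D g s)" "free D g x i"
      using free_acc_class[OF finD] by blast
    obtain g' j z where g': "j \<in> nonfull D g s" "proper (insert x D) g'"
     "\<And>k. card (cls (insert x D) g' k) = card (cls D g k) + (if k = j then 1 else 0)"
     "\<And>k. k \<in> nonfull D g s \<Longrightarrow> k \<noteq> j \<Longrightarrow> cls (insert x D) g' k = cls D g k"
      using place[OF prD xD i finD M(3)] by metis
    \<comment> \<open>Placing \<open>x\<close> fills only class \<open>j\<close>, so one of the two
      classes left by \<open>y1\<close> and \<open>y2\<close> keeps its gap and its
      vertices.\<close>
    obtain Y where Y: "Y \<in> {f y1, f y2}" "Y \<noteq> j" using False by auto
    show ?thesis
    proof (rule finish)
      show "fits (insert x D) g' s"
        using g' leD DV x unfolding fits_def nonfull_def by (auto simp: less_eq_Suc_le)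
      have clsY: "cls (insert x D) g' Y = cls D g Y" using g'(4) Y M by auto
      have "Y \<in> nonfull D g s" using Y M by auto
      then show "Y \<in> nonfull (insert x D) g' s" using clsY by (simp add: nonfull_def)
      have "degsum (cls D g Y) < (hi - a) * s" using Y(1) dlow by auto
      then show "degsum (cls (insert x D) g' Y) < hi * s" using hia unfolding clsY by linarith
      fix i assume i: "i < r"
      have "s \<le> card (cls D g i) + 1"
        using cardi[of i] cardi0 cY sz[OF i] by (cases "i = i0 \<or> i = f y1 \<or> i = f y2") auto
      then show "s \<le> card (cls (insert x D) g' i) + 1" using g'(3) by simp
    qed
  next
    case True
    define Y where "Y = f y1"
    have Yr: "Y < r" "Y \<noteq> i0" using yi unfolding Y_def by auto
    have cY: "card (cls D g Y) + 2 = s"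
    proof -
      have "cls D g Y = cls C f Y - {y1} - {y2}" using clsi[OF Yr(2)] by auto
      moreover have "y1 \<in> cls C f Y" "y2 \<in> cls C f Y - {y1}" using y True by (auto simp: cls_def Y_def)
      then have "card (cls C f Y) = Suc (Suc (card (cls C f Y - {y1} - {y2})))"
        using card.remove[OF fcls, of y1 Y] card.remove[of "cls C f Y - {y1}" y2] fcls[of Y] by (metis finite_Diff)
      ultimately show ?thesis using fullY(1) unfolding Y_def by simp
    qed
    have near: "s \<le> card (cls D g i) + 1" if "i < r" "i \<noteq> Y" for i
      using cardi[of i] cardi0 sz[OF that(1)] that True by (cases "i = i0") (auto simp: Y_def)
    \<comment> \<open>Nonfull classes other than \<open>Y\<close> were nonfull before, hence among
      the \<open>a\<close> accessible ones, and \<open>i0\<close> has become full.\<close>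
    have "card (nonfull D g s - {Y}) < a"
    proof -
      have "nonfull D g s - {Y} \<subseteq> nonfull C f s - {i0}"
      proof
        fix i assume i: "i \<in> nonfull D g s - {Y}"
        then have "i \<noteq> i0" using cardi0 by (auto simp: nonfull_def)
        moreover from this have "card (cls D g i) = card (cls C f i)" using i True cardi by (simp add: Y_def)
        ultimately show "i \<in> nonfull C f s - {i0}" using i by (simp add: nonfull_def)
      qed
      also have "nonfull C f s - {i0} \<subseteq> A - {i0}" using acc_target unfolding A_def nonfull_def by auto
      finally have "card (nonfull D g s - {Y}) \<le> card (A - {i0})"
        using finite_acc unfolding A_def by (intro card_mono) auto
      also have "\<dots> < a" unfolding a_def using i0A finite_acc unfolding A_def by (intro card_Diff1_less)
      finally show ?thesis .
    qed
    then obtain i where i: "i \<in> acc D g {Y}" "free D g x i"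
      using place_in_emptied_class[OF fitsD Yr(1) x(2) _ _ near a_lo ras] dlow(1) Y_def by blast
    \<comment> \<open>\<open>Y\<close> lacks two vertices; refilling it first brings it to
      \<open>s - 1\<close> and leaves one gap for \<open>w\<close>.\<close>
    have MY: "{Y} \<subseteq> {..<r}" using Yr by auto
    obtain g' z where g': "proper (insert x D) g'" "z \<in> insert x D"
     "\<And>k. card (cls (insert x D) g' k) = card (cls D g k) + (if k = Y then 1 else 0)"
     "cls (insert x D) g' Y = insert z (cls D g Y)"
      using place[OF prD xD i finD MY] by (metis singletonD)
    show ?thesis
    proof (rule finish)
      show "fits (insert x D) g' s"
        using g' leD DV x cY unfolding fits_def by auto
      show "Y \<in> nonfull (insert x D) g' s" using Yr cY g'(3) unfolding nonfull_def by auto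
      have "z \<in> V" using g'(2) DV x by auto
      \<comment> \<open>The vertex that arrives in \<open>Y\<close> costs at most \<open>r\<close>,
        which the reserve \<open>a * s\<close> covers.\<close>
      have "degsum (insert z (cls D g Y)) \<le> r + degsum (cls D g Y)"
      proof (cases "z \<in> cls D g Y")
        case False
        then show ?thesis unfolding degsum_def using nb_le[OF \<open>z \<in> V\<close>] finD by (simp add: cls_def)
      qed (simp add: insert_absorb)
      moreover have "real r \<le> real a * s" using ras by (metis of_nat_le_iff of_nat_mult)
      moreover have "(hi - a) * s + real a * s = hi * s" by (simp add: algebra_simps)
      ultimately show "degsum (cls (insert x D) g' Y) < hi * s"
        using dlow(1)[folded Y_def] unfolding g'(4) by linarith
      fix i assume i: "i < r"
      show "s \<le> card (cls (insert x D) g' i) + 1" using near[OF i] cY g'(3) by (cases "i = Y") auto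
    qed
  qed
qed

end

section \<open>Induction over the vertex set\<close>

lemma sparse_graph_subset:
  assumes "sparse_graph V adj r m1 m2 \<beta>" "W \<subseteq> V"
  shows "sparse_graph W adj r m1 m2 \<beta>"
proof -
  interpret sparse_graph V adj r m1 m2 \<beta> by fact
  show ?thesis
  proof
    show "finite W" using assms(2) finite_V by (rule finite_subset)
    show "nb adj v W \<le> r" if "v \<in> W" for v
      using nb_mono[OF assms(2) finite_V, of v] nb_le[of v] that assms(2) by force
  qed (use assms(2) adj_sym adj_irrefl density bip_density r_pos m1_pos m2_pos beta_ge beta_less
      m1_le m2_le in \<open>auto dest: subset_trans\<close>)
qed

theorem sparse_graph_balanced:
  assumes "sparse_graph V adj r m1 m2 \<beta>"
  shows "\<exists>f s. sparse_graph.balanced adj r V f s"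
proof -
  have "finite V" using assms by (simp add: sparse_graph_def symmetric_graph_def)
  then show ?thesis using assms
  proof (induction V rule: finite_psubset_induct)
    case (psubset V)
    interpret sparse_graph V adj r m1 m2 \<beta> by fact
    show ?case
    proof (cases "V = {}")
      case True
      have "balanced V (\<lambda>_. 0) 0" unfolding True balanced_def proper_def cls_def by simp
      then show ?thesis by blast
    next
      case False
      then obtain x where x: "x \<in> V" "real (nb adj x V) \<le> 2 * m1" by (rule exists_low_degree)
      then have "V - {x} \<subset> V" by auto
      then obtain f s where f: "balanced (V - {x}) f s"
        using psubset.IH sparse_graph_subset[OF psubset.prems] by blast
      show ?thesis
      proof (cases "nonfull (V - {x}) f s = {}")
        case False
        then show ?thesis using extend_balanced[OF x f] by blast
      next
        case True
        have "card (cls (V - {x}) f i) = s" if "i < r" for i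
        proof (rule le_antisym)
          show "card (cls (V - {x}) f i) \<le> s" using f that unfolding balanced_def by simp
          have "i \<notin> nonfull (V - {x}) f s" using True by simp
          then show "s \<le> card (cls (V - {x}) f i)" using that by (simp add: nonfull_def)
        qed
        \<comment> \<open>All classes have size \<open>s\<close>; regarded as one short of
          \<open>s + 1\<close>, they have room for \<open>x\<close>.\<close>
        then have "balanced (V - {x}) f (Suc s)" "0 \<in> nonfull (V - {x}) f (Suc s)"
          using f r_pos unfolding balanced_def nonfull_def by auto
        then show ?thesis using extend_balanced[OF x] by blast
      qed
    qed
  qed
qed

section \<open>From edge sets to adjacency\<close>

text \<open>The defining condition says \<open>p x \<ge> 0\<close>, and \<open>p\<close> decreases
  strictly on \<open>{1/2..1}\<close>, so the greatest solution is the root of \<open>p\<close>. The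
  bound \<open>m1 \<le> 1.8 * m2\<close> is exactly \<open>p (1/2) \<ge> 0\<close>.\<close>

lemma beta_root:
  assumes "0 < m1" "0 < m2" "m1 \<le> 1.8 * m2"
  shows "1/2 \<le> beta m1 m2" "beta m1 m2 < 1"
    "2 * m2 * (1 - beta m1 m2) * (1 + beta m1 m2)^2 = m1 * (beta m1 m2 * (2 + beta m1 m2))"
proof -
  define p where "p x = 2 * m2 * (1 - x) * (1 + x)^2 - m1 * (x * (2 + x))" for x :: real
  have "continuous_on {1/2..1} p" unfolding p_def by (intro continuous_intros)
  moreover have "p 1 \<le> 0" "0 \<le> p (1/2)" using assms unfolding p_def by (auto simp: power2_eq_square)
  ultimately obtain b where b: "1/2 \<le> b" "b \<le> 1" "p b = 0" using IVT2'[of p 1 0 "1/2"] by auto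
  have "p 1 \<noteq> 0" using assms unfolding p_def by simp
  then have b1: "b < 1" using b by (cases "b = 1") auto
  have iff: "2 * (1 - x) * (1 + x)^2 / (x * (x + 2)) \<ge> m1 / m2 \<longleftrightarrow> 0 \<le> p x" if "1/2 \<le> x" for x
  proof -
    have cross: "m1 / m2 \<le> n / d \<longleftrightarrow> m1 * d \<le> n * m2" if "0 < d" for n d
      using assms(2) that by (simp add: field_simps)
    have "0 < x * (x + 2)" using that by auto
    then have "2 * (1 - x) * (1 + x)^2 / (x * (x + 2)) \<ge> m1 / m2 \<longleftrightarrow>
        m1 * (x * (x + 2)) \<le> 2 * (1 - x) * (1 + x)^2 * m2"
      by (rule cross)
    then show ?thesis unfolding p_def by (simp add: algebra_simps)
  qed
  have dec: "p y < p x" if "1/2 \<le> x" "x < y" "y \<le> 1" for x y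
  proof -
    have "(1 - y) * (1 + y)^2 \<le> (1 - x) * (1 + x)^2"
    proof -
      have "(1 - x) * (1 + x)^2 - (1 - y) * (1 + y)^2 = (y - x) * (x\<^sup>2 + x * y + y\<^sup>2 + x + y - 1)"
        by (simp add: power2_eq_square algebra_simps)
      moreover have "0 \<le> x * y" "0 \<le> x\<^sup>2" "0 \<le> y\<^sup>2" using that by auto
      then have "0 \<le> (y - x) * (x\<^sup>2 + x * y + y\<^sup>2 + x + y - 1)"
        using that by (intro mult_nonneg_nonneg) linarith+
      ultimately show ?thesis by linarith
    qed
    then have "2 * m2 * ((1 - y) * (1 + y)^2) \<le> 2 * m2 * ((1 - x) * (1 + x)^2)"
      using assms by (intro mult_left_mono) auto
    moreover have "m1 * (x * (2 + x)) < m1 * (y * (2 + y))"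
      using assms that by (intro mult_strict_left_mono mult_strict_mono) auto
    ultimately show ?thesis unfolding p_def by (simp add: mult.assoc)
  qed
  have "beta m1 m2 = b" unfolding beta_def
  proof (rule Greatest_equality)
    show "b \<in> {1/2..<1} \<and> 2 * (1 - b) * (1 + b)^2 / (b * (b + 2)) \<ge> m1 / m2"
      using b b1 iff by auto
    fix y assume y: "y \<in> {1/2..<1} \<and> 2 * (1 - y) * (1 + y)^2 / (y * (y + 2)) \<ge> m1 / m2"
    then have "0 \<le> p y" using iff by auto
    then show "y \<le> b" using dec[of b y] y b by force
  qed
  then show "1/2 \<le> beta m1 m2" "beta m1 m2 < 1"
    "2 * m2 * (1 - beta m1 m2) * (1 + beta m1 m2)^2 = m1 * (beta m1 m2 * (2 + beta m1 m2))"
    using b b1 unfolding p_def by auto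
qed

lemma nb_eq_card_edges:
  assumes "graph V E" "u \<in> R"
  shows "nb (\<lambda>u v. {u, v} \<in> E) u R = card {e \<in> {e\<in>E. e \<subseteq> R}. u \<in> e}"
proof -
  have "{e \<in> {e\<in>E. e \<subseteq> R}. u \<in> e} = (\<lambda>v. {u, v}) ` {v\<in>R. {u, v} \<in> E}"
  proof (intro equalityI subsetI)
    fix e assume e: "e \<in> {e \<in> {e\<in>E. e \<subseteq> R}. u \<in> e}"
    then have "card e = 2" using assms(1) unfolding graph_def by auto
    then obtain x y where "e = {x, y}" by (auto simp: card_2_iff)
    then obtain v where "e = {u, v}" using e by auto
    then show "e \<in> (\<lambda>v. {u, v}) ` {v\<in>R. {u, v} \<in> E}" using e by auto
  qed (use assms(2) in auto)
  moreover have "inj_on (\<lambda>v. {u, v}) {v\<in>R. {u, v} \<in> E}" by (auto simp: inj_on_def doubleton_eq_iff)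
  ultimately show ?thesis unfolding nb_def by (simp add: card_image)
qed

lemma sparse_graph_in_class:
  assumes "0 < m1" "0 < m2" "m1 \<le> 1.8 * m2" "graph V E" "in_class m1 m2 V E"
    "real r \<ge> r0 m1 m2" "max_degree V E \<le> r"
  shows "sparse_graph V (\<lambda>u v. {u, v} \<in> E) r m1 m2 (beta m1 m2)"
proof -
  let ?adj = "\<lambda>u v. {u, v} \<in> E" and ?b = "beta m1 m2"
  note b = beta_root[OF assms(1-3)]
  have finV: "finite V" and E: "\<And>e. e \<in> E \<Longrightarrow> e \<subseteq> V \<and> card e = 2"
    using assms(4) unfolding graph_def by auto
  have finE: "finite E" using E finV by (intro finite_subset[of E "Pow V"]) auto
  have "2 * m1 / (1 - ?b) \<le> r" using assms(6) unfolding r0_def by simp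
  then have m1r: "2 * m1 \<le> (1 - ?b) * r" using b(2) by (simp add: pos_divide_le_eq mult.commute)
  have rpos: "r > 0"
  proof (rule ccontr)
    assume "\<not> ?thesis"
    then show False using m1r assms(1) by simp
  qed
  show ?thesis
  proof
    show "finite V" by (rule finV)
    show "?adj u v \<Longrightarrow> ?adj v u" for u v by (simp add: insert_commute)
    show "\<not> ?adj v v" for v using E[of "{v, v}"] by auto
    show "real (\<Sum>u\<in>R. nb ?adj u R) \<le> 2 * m1 * real (card R)" if R: "R \<subseteq> V" for R
    proof -
      let ?F = "{e\<in>E. e \<subseteq> R}"
      have finR: "finite R" using R finV by (rule finite_subset)
      have "(\<Sum>u\<in>R. nb ?adj u R) = (\<Sum>u\<in>R. card {e\<in>?F. u \<in> e})"
        using nb_eq_card_edges[OF assms(4)] by (intro sum.cong) auto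
      \<comment> \<open>Handshake count: each edge inside \<open>R\<close> is seen from both
        ends.\<close>
      also have "\<dots> = 2 * card ?F"
      proof (rule sum_multicount)
        show "\<forall>e\<in>?F. card {u\<in>R. u \<in> e} = 2"
        proof
          fix e assume e: "e \<in> ?F"
          then have "{u\<in>R. u \<in> e} = e" by auto
          then show "card {u\<in>R. u \<in> e} = 2" using e E by auto
        qed
      qed (use finR finE in auto)
      finally have "real (\<Sum>u\<in>R. nb ?adj u R) = 2 * real (card ?F)" by simp
      moreover have "subgraph R ?F V E" using R unfolding subgraph_def by auto
      ultimately show ?thesis using assms(5) unfolding in_class_def by fastforce
    qed
    show "real (\<Sum>u\<in>P. nb ?adj u Q) \<le> m2 * (real (card P) + real (card Q))"
      if P: "P \<subseteq> V" and Q: "Q \<subseteq> V" and PQ: "P \<inter> Q = {}" for P Q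
    proof -
      let ?S = "SIGMA u:P. {v\<in>Q. {u, v} \<in> E}"
      define F where "F = (\<lambda>(u, v). {u, v}) ` ?S"
      have fin: "finite P" "finite Q" using P Q finV finite_subset by blast+
      \<comment> \<open>As \<open>P\<close> and \<open>Q\<close> are disjoint, an edge determines
        which end lies in \<open>P\<close>.\<close>
      have inj: "inj_on (\<lambda>(u, v). {u, v}) ?S" using PQ by (auto simp: inj_on_def doubleton_eq_iff)
      have "(\<Sum>u\<in>P. nb ?adj u Q) = card F"
        unfolding F_def card_image[OF inj] nb_def using fin by simp
      moreover have "subgraph (P \<union> Q) F V E" using P Q unfolding subgraph_def F_def by auto
      moreover have "bipartite (P \<union> Q) F" unfolding bipartite_def
      proof (intro exI[of _ P] conjI ballI)
        fix e assume "e \<in> F"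
        then obtain u v where "u \<in> P" "v \<in> Q" "e = {u, v}" unfolding F_def by auto
        then have "e \<inter> P = {u}" "e - P = {v}" using PQ by auto
        then show "card (e \<inter> P) = 1" "card (e - P) = 1" by auto
      qed auto
      ultimately have "real (\<Sum>u\<in>P. nb ?adj u Q) \<le> m2 * real (card (P \<union> Q))"
        using assms(5) unfolding in_class_def by auto
      then show ?thesis using fin PQ by (simp add: card_Un_disjoint)
    qed
    show "nb ?adj v V \<le> r" if "v \<in> V" for v
    proof -
      have "{e \<in> {e\<in>E. e \<subseteq> V}. v \<in> e} = {e\<in>E. v \<in> e}" using E by auto
      then have "nb ?adj v V = degree E v" unfolding nb_eq_card_edges[OF assms(4) that] degree_def by simp
      also have "\<dots> \<le> max_degree V E" unfolding max_degree_def using that finV by (intro Max_ge) auto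
      finally show ?thesis using assms(7) by linarith
    qed
    show "4 * (1 + ?b)^2 * m2 \<le> ?b * (2 + ?b) * r"
    proof -
      \<comment> \<open>The root equation trades \<open>m2\<close> for \<open>m1\<close>, which
        \<open>m1r\<close> bounds; the positive factor \<open>1 - ?b\<close> then cancels.\<close>
      have "(1 - ?b) * (4 * (1 + ?b)^2 * m2) = 2 * m1 * (?b * (2 + ?b))"
        using b(3) by (simp add: algebra_simps)
      also have "\<dots> \<le> (1 - ?b) * r * (?b * (2 + ?b))"
        using m1r b by (intro mult_right_mono) auto
      finally have "(1 - ?b) * (4 * (1 + ?b)^2 * m2) \<le> (1 - ?b) * (?b * (2 + ?b) * r)"
        by (simp add: algebra_simps)
      then show ?thesis using b(2) by simp
    qed
  qed (use rpos b m1r assms in auto)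
qed

theorem theorem4:
  fixes m1 m2 :: real and V :: "'a set" and E :: "'a set set" and r :: nat
  assumes "m1 > 0" and "m2 > 0" and "m1 \<le> 1.8 * m2"
    and "graph V E" and "in_class m1 m2 V E"
    and "real r \<ge> r0 m1 m2"
    and "max_degree V E \<le> r"
  shows "\<exists>c. equitable_coloring V E r c"
proof -
  interpret sparse_graph V "\<lambda>u v. {u, v} \<in> E" r m1 m2 "beta m1 m2"
    using assms by (rule sparse_graph_in_class)
  obtain c s where c: "balanced V c s"
    using sparse_graph_balanced[OF sparse_graph_axioms] by blast
  have "c u \<noteq> c v" if e: "e \<in> E" "u \<in> e" "v \<in> e" "u \<noteq> v" for e u v
  proof -
    have "e \<subseteq> V" "card e = 2" using assms(4) e(1) unfolding graph_def by auto
    then have "e = {u, v}" "u \<in> V" "v \<in> V" using e by (auto simp: card_2_iff)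
    then show ?thesis using c e(1) unfolding balanced_def proper_def by blast
  qed
  moreover have "card {v\<in>V. c v = i} \<le> card {v\<in>V. c v = j} + 1" if "i < r" "j < r" for i j
    using c that unfolding balanced_def cls_def by (meson order_trans)
  ultimately have "equitable_coloring V E r c"
    using c unfolding equitable_coloring_def balanced_def proper_def by blast
  then show ?thesis by blast
qed

end
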